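(* Let $f \in \mathbb{C}[x_1,\dots,x_n]_d$ be a homogeneous polynomial of degree $d$ with border Waring rank $\underline{\mathsf{WR}}(f) = r$. Then $\mathsf{WR}(f) \le 4^r \cdot d$.
   Context: $\mathbb{C}[x_1,\dots,x_n]_d$ denotes the space of homogeneous polynomials of degree $d$ over $\mathbb{C}$. The Waring rank $\mathsf{WR}(f)$ is the smallest $r$ such that $f = \sum_{k=1}^r \ell_k^d$ for linear forms $\ell_k \in \mathbb{C}[x_1,\dots,x_n]_1$. The border Waring rank $\underline{\mathsf{WR}}(f)$ is the smallest $r$ such that $f = \lim_{\epsilon\to 0}\sum_{k=1}^r \ell_k(\epsilon)^d$, where each $\ell_k(\epsilon)$ is a linear form in $x_1,\dots,x_n$ whose coefficients are rational functions of $\epsilon$ (equivalently, the smallest $r$ such that $f$ lies in the closure of the set of degree-$d$ forms of Waring rank at most $r$). *)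

theory Defs
  imports "HOL-Analysis.Analysis"
begin

text \<open>Forms in n variables over C are represented as polynomial functions
  on C^n (the index type 'n is finite, CARD('n) = n). Over the infinite field C
  a polynomial is determined by its function.\<close>

definition monomial_exps :: "nat \<Rightarrow> ('n::finite \<Rightarrow> nat) set" where
  "monomial_exps d = {\<alpha>. (\<Sum>i\<in>UNIV. \<alpha> i) = d}"

definition homog_form :: "nat \<Rightarrow> (complex^'n::finite \<Rightarrow> complex) \<Rightarrow> bool" where
  "homog_form d f \<longleftrightarrow> (\<exists>c :: ('n \<Rightarrow> nat) \<Rightarrow> complex.
      \<forall>x. f x = (\<Sum>\<alpha>\<in>monomial_exps d. c \<alpha> * (\<Prod>i\<in>UNIV. (x $ i) ^ \<alpha> i)))"

definition lin_form :: "complex^'n::finite \<Rightarrow> complex^'n \<Rightarrow> complex" where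
  "lin_form a x = (\<Sum>i\<in>UNIV. a $ i * x $ i)"

definition waring_decomp :: "nat \<Rightarrow> (complex^'n::finite \<Rightarrow> complex) \<Rightarrow> nat \<Rightarrow> bool" where
  "waring_decomp d f r \<longleftrightarrow> (\<exists>a :: nat \<Rightarrow> complex^'n.
      f = (\<lambda>x. \<Sum>k<r. (lin_form (a k) x) ^ d))"

definition waring_rank :: "nat \<Rightarrow> (complex^'n::finite \<Rightarrow> complex) \<Rightarrow> nat" where
  "waring_rank d f = (LEAST r. waring_decomp d f r)"

text \<open>f lies in the closure of the set of degree-d forms of Waring rank at most r:
  f is a limit of sums of r d-th powers of linear forms. (Convergence in the
  finite-dimensional space of degree-d forms is equivalent to pointwise convergence.)\<close>
definition border_waring_decomp :: "nat \<Rightarrow> (complex^'n::finite \<Rightarrow> complex) \<Rightarrow> nat \<Rightarrow> bool" where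
  "border_waring_decomp d f r \<longleftrightarrow> (\<exists>A :: nat \<Rightarrow> nat \<Rightarrow> complex^'n.
      \<forall>x. (\<lambda>m. \<Sum>k<r. (lin_form (A m k) x) ^ d) \<longlonglongrightarrow> f x)"

definition border_waring_rank :: "nat \<Rightarrow> (complex^'n::finite \<Rightarrow> complex) \<Rightarrow> nat" where
  "border_waring_rank d f = (LEAST r. border_waring_decomp d f r)"

end

theory Submission
  imports Defs "HOL-Library.Function_Algebras"
begin

text \<open>
  Write \<open>f\<close> as the limit of \<open>\<Sum>k<r. \<langle>a\<^sub>k(m), x\<rangle>\<^sup>d\<close>. A direction orthogonal to all \<open>a\<^sub>k(m)\<close> leaves the
  \<open>m\<close>-th sum invariant, so by compactness \<open>f\<close> depends on at most \<open>r\<close> linear forms; this settles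
  the case \<open>d < r\<close> by counting monomials.

  For \<open>d \<ge> r\<close> pass to a subsequence and rescale to \<open>\<Sum>k<r. c\<^sub>k(m) \<langle>b\<^sub>k(m), x\<rangle>\<^sup>d\<close> with nodes \<open>b\<^sub>k(m)\<close> in an
  affine hyperplane \<open>z = 1\<close> converging to \<open>\<beta>\<^sub>k\<close>. The functionals \<open>p \<mapsto> \<Sum>k<r. c\<^sub>k(m) p(b\<^sub>k(m))\<close> converge on
  polynomials of degree \<open>d\<close>. As they vanish on \<open>q \<Prod>k<r. (u\<^sub>k - u\<^sub>k(b\<^sub>k(m)))\<close> for linear forms \<open>u\<^sub>k\<close>, which
  expresses degrees \<open>\<ge> r\<close> through lower ones with convergent coefficients, they converge on all
  polynomials, and the limit \<open>F\<close> kills \<open>q \<Prod>k<r. u\<^sub>k\<close> whenever every \<open>u\<^sub>k\<close> vanishes at \<open>\<beta>\<^sub>k\<close>.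

  If \<open>\<beta>\<^sub>i \<noteq> \<beta>\<^sub>j\<close>, split \<open>1 = u + u'\<close> on the hyperplane with \<open>u(\<beta>\<^sub>i) = 0\<close> and \<open>u'(\<beta>\<^sub>j) = 0\<close>: the functionals
  \<open>F(u \<cdot>)\<close> and \<open>F(u' \<cdot>)\<close> need one node less, so each such step doubles the bound and removes a node.
  If all \<open>s\<close> nodes left equal \<open>\<beta>\<close>, then \<open>F(\<langle>\<cdot>, x\<rangle>\<^sup>d)\<close> is a combination of \<open>\<langle>\<beta>, x\<rangle>\<^sup>d\<^sup>-\<^sup>i G\<^sub>i(x)\<close> with forms \<open>G\<^sub>i\<close>
  of degree \<open>i < s\<close>, hence of at most \<open>2\<^sup>r\<^sup>+\<^sup>s\<^sup>-\<^sup>1\<close> binary forms \<open>\<langle>\<beta>, x\<rangle>\<^sup>d\<^sup>-\<^sup>i \<langle>v, x\<rangle>\<^sup>i\<close>, each of Waring rank at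
  most \<open>d + 1 \<le> 2 d\<close>.
\<close>

section \<open>Powers of linear forms in spaces of functions\<close>

interpretation fun_space: vector_space "\<lambda>(c::complex) (f::'a \<Rightarrow> complex) x. c * f x"
  by unfold_locales (auto simp: fun_eq_iff algebra_simps plus_fun_def)

lemma sum_fun_apply: "(\<Sum>i\<in>I. (f i :: 'a \<Rightarrow> complex)) x = (\<Sum>i\<in>I. f i x)"
  by (induction I rule: infinite_finite_induct) (auto simp: zero_fun_def plus_fun_def)

lemma subspace_add_fun:
  "fun_space.subspace V \<Longrightarrow> u \<in> V \<Longrightarrow> v \<in> V \<Longrightarrow> (\<lambda>x. u x + c * v x) \<in> V"
  using fun_space.subspace_add[OF _ _ fun_space.subspace_scale, of V u v c]
  by (simp add: plus_fun_def)

lemma span_sum_fun: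
  assumes "\<And>i. i \<in> I \<Longrightarrow> f i \<in> fun_space.span S"
  shows "(\<lambda>x. \<Sum>i\<in>I. c i * f i x) \<in> fun_space.span S"
proof -
  have "(\<Sum>i\<in>I. (\<lambda>x. c i * f i x)) \<in> fun_space.span S"
    by (intro fun_space.span_sum fun_space.span_scale assms)
  also have "(\<Sum>i\<in>I. (\<lambda>x. c i * f i x)) = (\<lambda>x. \<Sum>i\<in>I. c i * f i x)"
    by (simp add: fun_eq_iff sum_fun_apply)
  finally show ?thesis .
qed

text \<open>Multiplication by \<open>g\<close> is linear, so its effect on a span is decided on the
  generators.\<close>

lemma span_mult_left:
  assumes "p \<in> fun_space.span S" "\<And>s. s \<in> S \<Longrightarrow> (\<lambda>x. g x * s x) \<in> fun_space.span T"
  shows "(\<lambda>x. g x * p x) \<in> fun_space.span T"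
proof -
  have sub: "fun_space.subspace {p. (\<lambda>x. g x * p x) \<in> fun_space.span T}"
  proof (rule fun_space.subspaceI)
    show "0 \<in> {p. (\<lambda>x. g x * p x) \<in> fun_space.span T}"
      using fun_space.span_zero[of T] by (simp add: zero_fun_def)
  next
    fix p q assume "p \<in> {p. (\<lambda>x. g x * p x) \<in> fun_space.span T}" "q \<in> {p. (\<lambda>x. g x * p x) \<in> fun_space.span T}"
    then show "p + q \<in> {p. (\<lambda>x. g x * p x) \<in> fun_space.span T}"
      using fun_space.span_add[of "\<lambda>x. g x * p x" T "\<lambda>x. g x * q x"]
      by (simp add: plus_fun_def algebra_simps)
  next
    fix c p assume "p \<in> {p. (\<lambda>x. g x * p x) \<in> fun_space.span T}"
    then show "(\<lambda>x. c * p x) \<in> {p. (\<lambda>x. g x * p x) \<in> fun_space.span T}"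
      using fun_space.span_scale[of "\<lambda>x. g x * p x" T c]
      by (simp add: algebra_simps)
  qed
  have "fun_space.span S \<subseteq> {p. (\<lambda>x. g x * p x) \<in> fun_space.span T}"
    by (rule fun_space.span_minimal[OF _ sub]) (use assms(2) in auto)
  then show ?thesis using assms(1) by auto
qed

text \<open>The number of terms is bounded through \<open>T\<close> while the terms come from
  \<open>S\<close>: a basis of the span of \<open>S\<close> chosen inside \<open>S\<close> is
  independent in the span of \<open>T\<close>. Later \<open>T\<close> counts monomials and
  \<open>S\<close> consists of products of powers of linear forms.\<close>

lemma in_span_few:
  assumes "finite T" "S \<subseteq> fun_space.span T" "h \<in> fun_space.span S"
  obtains B c where "B \<subseteq> S" "finite B" "card B \<le> card T" "h = (\<lambda>x. \<Sum>b\<in>B. c b * b x)"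
proof -
  obtain B where B: "B \<subseteq> S" "fun_space.independent B" "S \<subseteq> fun_space.span B"
    using fun_space.maximal_independent_subset[of S] by blast
  have fin: "finite B" "card B \<le> card T"
    using fun_space.independent_span_bound[OF assms(1) B(2)] B(1) assms(2) by auto
  have "h \<in> fun_space.span B"
    using assms(3) B(3) fun_space.span_mono fun_space.span_span by blast
  then obtain c where "h = (\<Sum>b\<in>B. (\<lambda>x. c b * b x))"
    unfolding fun_space.span_finite[OF fin(1)] by auto
  then have "h = (\<lambda>x. \<Sum>b\<in>B. c b * b x)"
    by (simp add: fun_eq_iff sum_fun_apply)
  with that B(1) fin show ?thesis by blast
qed

section \<open>Polarization: products of linear forms as combinations of powers\<close>

lemma vandermonde_solvable:
  "\<exists>c :: nat \<Rightarrow> complex. \<forall>j\<le>d. (\<Sum>k\<le>d. c k * of_nat k ^ j) = y j"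
proof (induction d arbitrary: y)
  case 0
  show ?case by (rule exI[of _ "\<lambda>_. y 0"]) simp
next
  case (Suc d)
  \<comment> \<open>Subtracting \<open>D\<close> times moment \<open>j\<close> from moment
    \<open>Suc j\<close> removes the node \<open>Suc d\<close>; the weights \<open>e\<close> solve
    the smaller system that is left.\<close>
  define D where "D = (of_nat (Suc d) :: complex)"
  obtain e where e: "\<And>j. j \<le> d \<Longrightarrow> (\<Sum>k\<le>d. e k * of_nat k ^ j) = y (Suc j) - D * y j"
    using Suc.IH[of "\<lambda>j. y (Suc j) - D * y j"] by blast
  define c' where "c' k = e k / (of_nat k - D)" for k
  \<comment> \<open>The weight of the new node is still free and is fixed by moment 0.\<close>
  define c where "c k = (if k = Suc d then y 0 - (\<Sum>k\<le>d. c' k) else c' k)" for k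
  have ec: "c k * (of_nat k - D) = e k" if "k \<le> d" for k
    using that by (simp add: c_def c'_def D_def del: of_nat_Suc)
  have "(\<Sum>k\<le>Suc d. c k * of_nat k ^ j) = y j" if "j \<le> Suc d" for j
    using that
  proof (induction j)
    case 0
    show ?case by (simp add: c_def)
  next
    case (Suc j)
    have "(\<Sum>k\<le>Suc d. c k * of_nat k ^ Suc j) - D * (\<Sum>k\<le>Suc d. c k * of_nat k ^ j)
        = (\<Sum>k\<le>Suc d. (c k * (of_nat k - D)) * of_nat k ^ j)"
      by (simp only: sum_distrib_left sum_subtractf[symmetric])
         (intro sum.cong, auto simp: algebra_simps)
    also have "\<dots> = (\<Sum>k\<le>d. e k * of_nat k ^ j)"
      using ec by (simp add: D_def)
    also have "\<dots> = y (Suc j) - D * y j"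
      using Suc.prems by (intro e) auto
    finally show ?case
      using Suc by simp
  qed
  then show ?case by blast
qed

text \<open>Expand each power on the right binomially; the weights from
  \<open>vandermonde_solvable\<close> retain only the term with exponent \<open>i\<close>. They
  depend on neither \<open>L\<close> nor \<open>M\<close>, so they serve for any two linear forms,
  at the cost of \<open>d + 1\<close> powers.\<close>

lemma mixed_power_eq_sum_powers:
  assumes "i \<le> d"
  obtains c where "\<And>L M :: complex. L ^ (d - i) * M ^ i = (\<Sum>k\<le>d. c k * (L + of_nat k * M) ^ d)"
proof -
  obtain c :: "nat \<Rightarrow> complex" where
    c: "\<And>j. j \<le> d \<Longrightarrow> (\<Sum>k\<le>d. c k * of_nat k ^ j) = (if j = i then 1 / of_nat (d choose i) else 0)"
    using vandermonde_solvable[of d "\<lambda>j. if j = i then 1 / of_nat (d choose i) else 0"] by blast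
  have "L ^ (d - i) * M ^ i = (\<Sum>k\<le>d. c k * (L + of_nat k * M) ^ d)" for L M :: complex
  proof -
    have "(\<Sum>k\<le>d. c k * (L + of_nat k * M) ^ d)
        = (\<Sum>k\<le>d. \<Sum>j\<le>d. of_nat (d choose j) * M ^ j * L ^ (d - j) * (c k * of_nat k ^ j))"
      by (subst add.commute, subst binomial_ring)
         (simp add: sum_distrib_left power_mult_distrib algebra_simps)
    also have "\<dots> = (\<Sum>j\<le>d. of_nat (d choose j) * M ^ j * L ^ (d - j) * (\<Sum>k\<le>d. c k * of_nat k ^ j))"
      by (subst sum.swap) (simp add: sum_distrib_left)
    also have "\<dots> = (\<Sum>j\<le>d. if j = i then M ^ i * L ^ (d - i) else 0)"
      using assms by (intro sum.cong refl) (auto simp: c)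
    also have "\<dots> = L ^ (d - i) * M ^ i"
      using assms by simp
    finally show ?thesis by simp
  qed
  with that show ?thesis by blast
qed

text \<open>Induction on the list: \<open>u\<close> times a power of \<open>v\<close> is a mixed
  power, hence a combination of powers of \<open>u + k v\<close>, and these bases stay in
  \<open>V\<close>.\<close>

lemma prod_list_in_span_powers:
  assumes V: "fun_space.subspace V" and us: "set us \<subseteq> V"
  shows "(\<lambda>x. \<Prod>u\<leftarrow>us. u x) \<in> fun_space.span ((\<lambda>v x. v x ^ length us) ` V)"
  using us
proof (induction us)
  case Nil
  have "(\<lambda>x. 1) \<in> (\<lambda>v x. v x ^ length []) ` V"
    using fun_space.subspace_0[OF V] by auto
  then show ?case by (simp add: fun_space.span_base)
next
  case (Cons u us)
  have "(\<lambda>x. u x * (\<Prod>u\<leftarrow>us. u x)) \<in> fun_space.span ((\<lambda>v x. v x ^ length (u # us)) ` V)"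
  proof (rule span_mult_left)
    show "(\<lambda>x. \<Prod>u\<leftarrow>us. u x) \<in> fun_space.span ((\<lambda>v x. v x ^ length us) ` V)"
      using Cons by auto
    fix s assume "s \<in> (\<lambda>v x. v x ^ length us) ` V"
    then obtain v where v: "v \<in> V" "s = (\<lambda>x. v x ^ length us)" by auto
    obtain c where c: "\<And>L M :: complex. L ^ (Suc (length us) - length us) * M ^ length us
        = (\<Sum>k\<le>Suc (length us). c k * (L + of_nat k * M) ^ Suc (length us))"
      using mixed_power_eq_sum_powers[of "length us" "Suc (length us)"] by auto
    have "(\<lambda>x. \<Sum>k\<le>Suc (length us). c k * (u x + of_nat k * v x) ^ Suc (length us))
        \<in> fun_space.span ((\<lambda>v x. v x ^ length (u # us)) ` V)"
    proof (rule span_sum_fun)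
      fix k
      have "(\<lambda>x. u x + of_nat k * v x) \<in> V"
        using Cons v(1) by (intro subspace_add_fun V) auto
      then show "(\<lambda>x. (u x + of_nat k * v x) ^ Suc (length us))
          \<in> fun_space.span ((\<lambda>v x. v x ^ length (u # us)) ` V)"
        by (intro fun_space.span_base) auto
    qed
    moreover have "(\<lambda>x. u x * s x) = (\<lambda>x. \<Sum>k\<le>Suc (length us). c k * (u x + of_nat k * v x) ^ Suc (length us))"
      using c[of "u _" "v _"] v(2) by (simp add: fun_eq_iff Suc_diff_le)
    ultimately show "(\<lambda>x. u x * s x) \<in> fun_space.span ((\<lambda>v x. v x ^ length (u # us)) ` V)"
      by simp
  qed
  then show ?case by simp
qed

text \<open>Coefficients are left out since they can be absorbed by taking d-th roots. The space
  \<open>V\<close> of linear forms is a parameter so that the same count serves for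
  \<open>lin N\<close> and for \<open>lin_form\<close>.\<close>

definition power_sum :: "('a \<Rightarrow> complex) set \<Rightarrow> nat \<Rightarrow> nat \<Rightarrow> ('a \<Rightarrow> complex) \<Rightarrow> bool" where
  "power_sum V d n h \<longleftrightarrow> (\<exists>v. (\<forall>k<n. v k \<in> V) \<and> h = (\<lambda>x. \<Sum>k<n. v k x ^ d))"

lemma power_sum_0: "power_sum V d 0 (\<lambda>x. 0)"
  by (simp add: power_sum_def)

lemma power_sum_add:
  assumes "power_sum V d m g" "power_sum V d n h"
  shows "power_sum V d (m + n) (\<lambda>x. g x + h x)"
proof -
  obtain u v where uv: "\<forall>k<m. u k \<in> V" "g = (\<lambda>x. \<Sum>k<m. u k x ^ d)"
    "\<forall>k<n. v k \<in> V" "h = (\<lambda>x. \<Sum>k<n. v k x ^ d)"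
    using assms unfolding power_sum_def by blast
  define w where "w k = (if k < m then u k else v (k - m))" for k
  have "(\<Sum>k<m+n. w k x ^ d) = g x + h x" for x
    unfolding uv(2,4) by (simp add: lessThan_atLeast0 sum.atLeastLessThan_concat[of 0 m "m+n", symmetric])
       (use sum.shift_bounds_nat_ivl[of "\<lambda>k. w k x ^ d" 0 m n] in \<open>simp add: w_def add.commute\<close>)
  then show ?thesis
    unfolding power_sum_def using uv(1,3) by (intro exI[of _ w]) (auto simp: w_def)
qed

lemma power_sum_mono:
  assumes "power_sum V d m g" "m \<le> n" "fun_space.subspace V" "d \<ge> 1"
  shows "power_sum V d n g"
proof -
  have "power_sum V d k (\<lambda>x. 0)" for k
    unfolding power_sum_def using fun_space.subspace_0[OF assms(3)] assms(4)
    by (intro exI[of _ "\<lambda>_. 0"]) auto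
  from power_sum_add[OF assms(1) this[of "n - m"]] show ?thesis
    using assms(2) by simp
qed

lemma power_sum_scaled_power:
  assumes "fun_space.subspace V" "d \<ge> 1" "v \<in> V"
  shows "power_sum V d 1 (\<lambda>x. c * v x ^ d)"
proof -
  obtain w where "c = w ^ d"
    using exists_complex_root[of d c] assms(2) by auto
  then show ?thesis
    unfolding power_sum_def using fun_space.subspace_scale[OF assms(1,3), of w]
    by (intro exI[of _ "\<lambda>_ x. w * v x"]) (auto simp: power_mult_distrib)
qed

lemma power_sum_sum:
  assumes "finite I" "\<And>i. i \<in> I \<Longrightarrow> power_sum V d n (h i)"
  shows "power_sum V d (card I * n) (\<lambda>x. \<Sum>i\<in>I. h i x)"
  using assms
proof (induction I rule: finite_induct)
  case empty
  then show ?case by (simp add: power_sum_0)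
next
  case (insert i I)
  then show ?case
    using power_sum_add[of V d n "h i" "card I * n" "\<lambda>x. \<Sum>i\<in>I. h i x"] by simp
qed

lemma power_sum_mixed_power:
  assumes "fun_space.subspace V" "d \<ge> 1" "u \<in> V" "v \<in> V" "i \<le> d"
  shows "power_sum V d (d + 1) (\<lambda>x. a * (u x ^ (d - i) * v x ^ i))"
proof -
  obtain c where c: "\<And>L M :: complex. L ^ (d - i) * M ^ i = (\<Sum>k\<le>d. c k * (L + of_nat k * M) ^ d)"
    using mixed_power_eq_sum_powers[OF assms(5)] by blast
  have "power_sum V d (card {..d} * 1) (\<lambda>x. \<Sum>k\<le>d. a * c k * (u x + of_nat k * v x) ^ d)"
    using assms subspace_add_fun by (intro power_sum_sum power_sum_scaled_power) auto
  then show ?thesis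
    by (simp add: c sum_distrib_left mult.assoc)
qed

text \<open>Only existence matters here: it provides some Waring decomposition of a form, so that
  the minimum defining the border rank is attained.\<close>

lemma power_sum_of_span:
  assumes "fun_space.subspace V" "d \<ge> 1" "h \<in> fun_space.span ((\<lambda>v x. v x ^ d) ` V)"
  shows "\<exists>n. power_sum V d n h"
proof -
  obtain S c where S: "finite S" "S \<subseteq> (\<lambda>v x. v x ^ d) ` V" "h = (\<Sum>b\<in>S. (\<lambda>x. c b * b x))"
    using assms(3) unfolding fun_space.span_explicit by blast
  have "power_sum V d (card S * 1) (\<lambda>x. \<Sum>b\<in>S. c b * b x)"
  proof (rule power_sum_sum[OF S(1)])
    fix b assume "b \<in> S"
    then obtain v where "v \<in> V" "b = (\<lambda>x. v x ^ d)" using S(2) by auto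
    then show "power_sum V d 1 (\<lambda>x. c b * b x)"
      using power_sum_scaled_power[OF assms(1,2)] by simp
  qed
  moreover have "h = (\<lambda>x. \<Sum>b\<in>S. c b * b x)"
    using S(3) by (simp add: fun_eq_iff sum_fun_apply)
  ultimately show ?thesis by auto
qed

section \<open>Forms in finitely many indexed variables\<close>

text \<open>The number \<open>N\<close> of variables is only found during the proof, so it is a
  number and not a type; entries from \<open>N\<close> on are ignored. The pairing is symmetric:
  either argument may be read as the coefficients.\<close>

definition lin :: "nat \<Rightarrow> (nat \<Rightarrow> complex) \<Rightarrow> (nat \<Rightarrow> complex) \<Rightarrow> complex" where
  "lin N w b = (\<Sum>l<N. w l * b l)"

lemma lin_add_scale: "lin N (\<lambda>l. u l + c * v l) b = lin N u b + c * lin N v b"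
  by (simp add: lin_def sum.distrib sum_distrib_left algebra_simps)

lemma lin_commute: "lin N u b = lin N b u"
  by (simp add: lin_def mult.commute)

lemma lin_unit: "l < N \<Longrightarrow> lin N (\<lambda>j. if j = l then 1 else 0) b = b l"
  by (simp add: lin_def if_distrib[of "\<lambda>x. x * _"] cong: if_cong)

lemma subspace_range_lin: "fun_space.subspace (range (lin N))"
proof (rule fun_space.subspaceI)
  show "0 \<in> range (lin N)"
    by (rule range_eqI[of _ _ "\<lambda>_. 0"]) (simp add: fun_eq_iff lin_def)
next
  fix p q assume "p \<in> range (lin N)" "q \<in> range (lin N)"
  then obtain u v where "p = lin N u" "q = lin N v" by auto
  then show "p + q \<in> range (lin N)"
    using lin_add_scale[of N u 1 v] by (intro range_eqI[of _ _ "\<lambda>l. u l + 1 * v l"]) (simp add: fun_eq_iff)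
next
  fix c p assume "p \<in> range (lin N)"
  then obtain u where "p = lin N u" by auto
  then show "(\<lambda>x. c * p x) \<in> range (lin N)"
    using lin_add_scale[of N "\<lambda>_. 0" c u]
    by (intro range_eqI[of _ _ "\<lambda>l. 0 + c * u l"]) (simp add: fun_eq_iff lin_def)
qed

section \<open>Monomials of bounded degree and their number\<close>

definition exps :: "nat \<Rightarrow> nat \<Rightarrow> (nat \<Rightarrow> nat) set" where
  "exps N s = {\<alpha>. (\<forall>l\<ge>N. \<alpha> l = 0) \<and> (\<Sum>l<N. \<alpha> l) < s}"

text \<open>Pascal's rule: an exponent vector either has last entry 0 or arises from one with a
  smaller degree bound by raising the last entry. The factor 2 encodes the exponent
  \<open>N + s - 1\<close> without subtraction and later pays for
  \<open>d + 1 \<le> 2 * d\<close>.\<close>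

lemma card_exps: "finite (exps N s) \<and> 2 * card (exps N s) \<le> 2 ^ (N + s)"
proof (induction "N + s" arbitrary: N s)
  case 0
  then show ?case by (simp add: exps_def)
next
  case (Suc n)
  show ?case
  proof (cases s)
    case 0
    then show ?thesis by (simp add: exps_def)
  next
    case s: (Suc s')
    show ?thesis
    proof (cases N)
      case 0
      then have "exps N s = {\<lambda>_. 0}" using s by (auto simp: exps_def)
      then show ?thesis using s 0 by simp
    next
      case N: (Suc N')
      let ?bump = "\<lambda>\<alpha>. \<alpha>(N' := Suc (\<alpha> N'))"
      have "exps N s \<subseteq> exps N' s \<union> ?bump ` exps N s'"
      proof
        fix \<alpha> assume a: "\<alpha> \<in> exps N s"
        show "\<alpha> \<in> exps N' s \<union> ?bump ` exps N s'"
        proof (cases "\<alpha> N'")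
          case 0
          have "\<alpha> l = 0" if "l \<ge> N'" for l
            using a that 0 N by (cases "l = N'") (auto simp: exps_def)
          then show ?thesis using a 0 N by (auto simp: exps_def)
        next
          case (Suc m)
          have "\<alpha>(N' := m) \<in> exps N s'"
            using a Suc N s by (auto simp: exps_def)
          moreover have "\<alpha> = ?bump (\<alpha>(N' := m))"
            using Suc by (simp add: fun_eq_iff)
          ultimately show ?thesis by blast
        qed
      qed
      moreover have IH: "finite (exps N' s)" "2 * card (exps N' s) \<le> 2 ^ (N' + s)"
          "finite (exps N s')" "2 * card (exps N s') \<le> 2 ^ (N + s')"
        using Suc.hyps(1)[of N' s] Suc.hyps(1)[of N s'] Suc.hyps(2) N s by auto
      ultimately have fin: "finite (exps N s)"
        and "card (exps N s) \<le> card (exps N' s \<union> ?bump ` exps N s')"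
        by (auto intro: finite_subset card_mono)
      moreover have "\<dots> \<le> card (exps N' s) + card (exps N s')"
        using card_Un_le[of "exps N' s" "?bump ` exps N s'"] card_image_le[OF IH(3), of ?bump]
        by linarith
      ultimately show ?thesis using IH(2,4) N s by simp
    qed
  qed
qed

text \<open>Lists of indices instead of exponent vectors make multiplication by a variable a mere
  \<open>#\<close>; different listings of a monomial collapse to the same function.\<close>

definition monom_funs :: "nat \<Rightarrow> nat \<Rightarrow> ((nat \<Rightarrow> complex) \<Rightarrow> complex) set" where
  "monom_funs N i = {\<lambda>x. \<Prod>l\<leftarrow>is. x l | is. length is = i \<and> set is \<subseteq> {..<N}}"

lemma monom_funs_Suc: "p \<in> monom_funs N i \<Longrightarrow> l < N \<Longrightarrow> (\<lambda>x. x l * p x) \<in> monom_funs N (Suc i)"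
proof -
  assume "p \<in> monom_funs N i" "l < N"
  then obtain "is" where "p = (\<lambda>x. \<Prod>l\<leftarrow>is. x l)" "length is = i" "set is \<subseteq> {..<N}"
    by (auto simp: monom_funs_def)
  then show ?thesis
    unfolding monom_funs_def using \<open>l < N\<close> by (intro CollectI exI[of _ "l # is"]) auto
qed

lemma span_monom_funs_Suc:
  assumes "\<And>l. l < N \<Longrightarrow> p l \<in> fun_space.span (monom_funs N i)"
  shows "(\<lambda>x. \<Sum>l<N. x l * p l x) \<in> fun_space.span (monom_funs N (Suc i))"
  using span_sum_fun[of "{..<N}" "\<lambda>l x. x l * p l x" "monom_funs N (Suc i)" "\<lambda>_. 1"]
    span_mult_left[OF assms, of _ "\<lambda>x. x _" "monom_funs N (Suc i)"]
  by (auto intro: fun_space.span_base monom_funs_Suc)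

lemma lin_power_in_span_monom_funs: "(\<lambda>x. lin N v x ^ i) \<in> fun_space.span (monom_funs N i)"
proof (induction i)
  case 0
  have "(\<lambda>x. 1) \<in> monom_funs N 0" by (auto simp: monom_funs_def)
  then show ?case by (simp add: fun_space.span_base)
next
  case (Suc i)
  have "(\<lambda>x. \<Sum>l<N. x l * (v l * lin N v x ^ i)) \<in> fun_space.span (monom_funs N (Suc i))"
    by (intro span_monom_funs_Suc fun_space.span_scale Suc)
  also have "(\<lambda>x. \<Sum>l<N. x l * (v l * lin N v x ^ i)) = (\<lambda>x. lin N v x ^ Suc i)"
    by (simp add: fun_eq_iff lin_def sum_distrib_right mult_ac)
  finally show ?case .
qed

lemma monom_funs_subset_span_powers: "monom_funs N i \<subseteq> fun_space.span ((\<lambda>v x. v x ^ i) ` range (lin N))"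
proof
  fix p assume "p \<in> monom_funs N i"
  then obtain "is" where i: "p = (\<lambda>x. \<Prod>l\<leftarrow>is. x l)" "length is = i" "set is \<subseteq> {..<N}"
    by (auto simp: monom_funs_def)
  define us where "us = map (\<lambda>l. lin N (\<lambda>j. if j = l then 1 else 0)) is"
  have "(\<lambda>x. \<Prod>u\<leftarrow>us. u x) \<in> fun_space.span ((\<lambda>v x. v x ^ length us) ` range (lin N))"
    by (rule prod_list_in_span_powers[OF subspace_range_lin]) (auto simp: us_def)
  moreover have "(\<lambda>x. \<Prod>u\<leftarrow>us. u x) = p"
  proof
    fix x
    have "map (\<lambda>u. u x) us = map x is"
      unfolding us_def using i(3) by (auto simp: lin_unit)
    then show "(\<Prod>u\<leftarrow>us. u x) = p x" by (simp add: i(1))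
  qed
  ultimately show "p \<in> fun_space.span ((\<lambda>v x. v x ^ i) ` range (lin N))"
    using i(2) by (simp add: us_def)
qed

text \<open>Passing from index lists to exponent vectors makes the count \<open>card_exps\<close>
  available.\<close>

lemma monom_funs_as_exponents:
  assumes "p \<in> monom_funs N i"
  obtains \<alpha> where "\<forall>l\<ge>N. \<alpha> l = 0" "(\<Sum>l<N. \<alpha> l) = i" "p = (\<lambda>x. \<Prod>l<N. x l ^ \<alpha> l)"
proof -
  have *: "set is \<subseteq> {..<N} \<Longrightarrow> \<exists>\<alpha>. (\<forall>l\<ge>N. \<alpha> l = 0) \<and> (\<Sum>l<N. \<alpha> l) = length is \<and>
      (\<forall>x :: nat \<Rightarrow> complex. (\<Prod>l\<leftarrow>is. x l) = (\<Prod>l<N. x l ^ \<alpha> l))" for "is"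
  proof (induction "is")
    case Nil
    show ?case by (rule exI[of _ "\<lambda>_. 0"]) simp
  next
    case (Cons a "is")
    then obtain \<alpha> where \<alpha>: "\<forall>l\<ge>N. \<alpha> l = 0" "(\<Sum>l<N. \<alpha> l) = length is"
      "\<And>x :: nat \<Rightarrow> complex. (\<Prod>l\<leftarrow>is. x l) = (\<Prod>l<N. x l ^ \<alpha> l)" by auto
    have a: "a \<in> {..<N}" using Cons.prems by auto
    have "(\<Sum>l<N. (\<alpha>(a := Suc (\<alpha> a))) l) = Suc (\<Sum>l<N. \<alpha> l)"
      using a by (simp add: sum.remove[of _ a])
    moreover have "(\<Prod>l<N. x l ^ (\<alpha>(a := Suc (\<alpha> a))) l) = x a * (\<Prod>l<N. x l ^ \<alpha> l)"
      for x :: "nat \<Rightarrow> complex"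
      using a by (simp add: prod.remove[of _ a])
    ultimately show ?case
      using \<alpha> a by (intro exI[of _ "\<alpha>(a := Suc (\<alpha> a))"]) auto
  qed
  from assms obtain "is" where "p = (\<lambda>x. \<Prod>l\<leftarrow>is. x l)" "length is = i" "set is \<subseteq> {..<N}"
    by (auto simp: monom_funs_def)
  with *[of "is"] that show ?thesis by (auto simp: fun_eq_iff)
qed

text \<open>Counting monomials bounds the dimension of the span by half of
  \<open>2 ^ (N + s)\<close>. By polarization the binary forms in \<open>?S\<close> span the same
  space, so that many of them suffice, and each costs \<open>d + 1 \<le> 2 * d\<close>
  powers.\<close>

lemma power_sum_span_osculating:
  assumes "d \<ge> 1"
    and h: "h \<in> fun_space.span (\<Union>i\<in>{i. i < s \<and> i \<le> d}. (\<lambda>p x. lin N \<beta> x ^ (d - i) * p x) ` monom_funs N i)"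
  shows "power_sum (range (lin N)) d (2 ^ (N + s) * d) h"
proof -
  let ?U = "\<Union>i\<in>{i. i < s \<and> i \<le> d}. (\<lambda>p x. lin N \<beta> x ^ (d - i) * p x) ` monom_funs N i"
  let ?S = "\<Union>i\<in>{i. i < s \<and> i \<le> d}. (\<lambda>v x. lin N \<beta> x ^ (d - i) * lin N v x ^ i) ` UNIV"
  let ?T = "(\<lambda>\<alpha> x. lin N \<beta> x ^ (d - (\<Sum>l<N. \<alpha> l)) * (\<Prod>l<N. x l ^ \<alpha> l)) ` exps N s"
  have UT: "?U \<subseteq> ?T"
  proof
    fix q assume "q \<in> ?U"
    then obtain i p where ip: "i < s" "p \<in> monom_funs N i" "q = (\<lambda>x. lin N \<beta> x ^ (d - i) * p x)" by auto
    obtain \<alpha> where "\<forall>l\<ge>N. \<alpha> l = 0" "(\<Sum>l<N. \<alpha> l) = i" "p = (\<lambda>x. \<Prod>l<N. x l ^ \<alpha> l)"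
      using monom_funs_as_exponents[OF ip(2)] by blast
    then show "q \<in> ?T" using ip by (intro image_eqI[of _ _ \<alpha>]) (auto simp: exps_def)
  qed
  have "?S \<subseteq> fun_space.span ?U"
  proof
    fix q assume "q \<in> ?S"
    then obtain i v where iv: "i < s" "i \<le> d" "q = (\<lambda>x. lin N \<beta> x ^ (d - i) * lin N v x ^ i)" by auto
    show "q \<in> fun_space.span ?U"
      unfolding iv(3) by (rule span_mult_left[OF lin_power_in_span_monom_funs])
        (use iv in \<open>auto intro!: fun_space.span_base\<close>)
  qed
  then have ST: "?S \<subseteq> fun_space.span ?T"
    using fun_space.span_mono[OF UT] by blast
  have "?U \<subseteq> fun_space.span ?S"
  proof
    fix q assume "q \<in> ?U"
    then obtain i p where ip: "i < s" "i \<le> d" "p \<in> monom_funs N i" "q = (\<lambda>x. lin N \<beta> x ^ (d - i) * p x)" by auto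
    have "p \<in> fun_space.span ((\<lambda>v x. v x ^ i) ` range (lin N))"
      using monom_funs_subset_span_powers ip(3) by blast
    then show "q \<in> fun_space.span ?S"
      unfolding ip(4) by (rule span_mult_left) (use ip in \<open>auto intro!: fun_space.span_base\<close>)
  qed
  then have hS: "h \<in> fun_space.span ?S"
    using h fun_space.span_mono fun_space.span_span by blast
  obtain B c where B: "B \<subseteq> ?S" "finite B" "card B \<le> card ?T" "h = (\<lambda>x. \<Sum>b\<in>B. c b * b x)"
    using in_span_few[OF _ ST hS] card_exps by blast
  have "power_sum (range (lin N)) d (card B * (d + 1)) h"
    unfolding B(4)
  proof (rule power_sum_sum[OF B(2)])
    fix b assume "b \<in> B"
    then obtain i v where "i \<le> d" "b = (\<lambda>x. lin N \<beta> x ^ (d - i) * lin N v x ^ i)" using B(1) by auto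
    then show "power_sum (range (lin N)) d (d + 1) (\<lambda>x. c b * b x)"
      using power_sum_mixed_power[OF subspace_range_lin assms(1)] by auto
  qed
  moreover have "card B * (d + 1) \<le> 2 ^ (N + s) * d"
  proof -
    have "card B \<le> card (exps N s)"
      using B(3) card_image_le card_exps le_trans by blast
    then have "card B * (d + 1) \<le> card (exps N s) * (2 * d)"
      using assms(1) by (intro mult_mono) auto
    also have "\<dots> \<le> 2 ^ (N + s) * d"
      using card_exps[of N s] by simp
    finally show ?thesis .
  qed
  ultimately show ?thesis
    using power_sum_mono subspace_range_lin assms(1) by blast
qed

section \<open>Polynomial functions and linear functionals on them\<close>

inductive_set polys :: "nat \<Rightarrow> ((nat \<Rightarrow> complex) \<Rightarrow> complex) set" for N where
  one: "(\<lambda>b. 1) \<in> polys N"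
| lin_mult: "p \<in> polys N \<Longrightarrow> (\<lambda>b. lin N w b * p b) \<in> polys N"
| add_scale: "p \<in> polys N \<Longrightarrow> q \<in> polys N \<Longrightarrow> (\<lambda>b. p b + c * q b) \<in> polys N"

lemma polys_mult: "p \<in> polys N \<Longrightarrow> q \<in> polys N \<Longrightarrow> (\<lambda>b. p b * q b) \<in> polys N"
proof (induction rule: polys.induct)
  case one
  then show ?case by simp
next
  case (lin_mult p w)
  then show ?case using polys.lin_mult[of "\<lambda>b. p b * q b" N w] by (simp add: mult.assoc)
next
  case (add_scale p p' c)
  then show ?case using polys.add_scale[of "\<lambda>b. p b * q b" N "\<lambda>b. p' b * q b" c]
    by (simp add: algebra_simps)
qed

lemma polys_lin: "lin N w \<in> polys N"
  using polys.lin_mult[OF polys.one, of N w] by simp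

lemma polys_power: "p \<in> polys N \<Longrightarrow> (\<lambda>b. p b ^ n) \<in> polys N"
  by (induction n) (auto intro: polys.one polys_mult)

lemma polys_prod: "(\<And>k. k \<in> K \<Longrightarrow> p k \<in> polys N) \<Longrightarrow> (\<lambda>b. \<Prod>k\<in>K. p k b) \<in> polys N"
  by (induction K rule: infinite_finite_induct) (auto intro: polys.one polys_mult)

lemma polys_0: "(\<lambda>b. 0) \<in> polys N"
  using polys.add_scale[OF polys.one polys.one, where c = "-1"] by simp

lemma polys_sum: "(\<And>i. i \<in> I \<Longrightarrow> p i \<in> polys N) \<Longrightarrow> (\<lambda>b. \<Sum>i\<in>I. c i * p i b) \<in> polys N"
proof (induction I rule: infinite_finite_induct)
  case (insert i I)
  then show ?case
    using polys.add_scale[of "\<lambda>b. \<Sum>i\<in>I. c i * p i b" N "p i" "c i"]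
    by (simp add: add.commute)
qed (auto intro: polys_0)

text \<open>Linearity is demanded on polynomials only, because the functional of interest is a
  \<open>lim\<close>, which is meaningful where convergence is known.\<close>

definition linear_on_polys :: "nat \<Rightarrow> (((nat \<Rightarrow> complex) \<Rightarrow> complex) \<Rightarrow> complex) \<Rightarrow> bool" where
  "linear_on_polys N F \<longleftrightarrow>
    (\<forall>p\<in>polys N. \<forall>q\<in>polys N. \<forall>c. F (\<lambda>b. p b + c * q b) = F p + c * F q)"

lemma linear_on_polysD:
  assumes "linear_on_polys N F" "p \<in> polys N" "q \<in> polys N"
  shows "F (\<lambda>b. p b + c * q b) = F p + c * F q"
  using assms(1)[unfolded linear_on_polys_def, rule_format, OF assms(2,3)] .

lemma linear_on_polys_sum:
  assumes F: "linear_on_polys N F" and "finite I" "\<And>i. i \<in> I \<Longrightarrow> p i \<in> polys N"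
  shows "F (\<lambda>b. \<Sum>i\<in>I. c i * p i b) = (\<Sum>i\<in>I. c i * F (p i))"
  using assms(2,3)
proof (induction I rule: finite_induct)
  case empty
  have "F (\<lambda>b. 1 + (-1) * 1) = F (\<lambda>b. 1) + (-1) * F (\<lambda>b. 1)"
    by (rule linear_on_polysD[OF F polys.one polys.one])
  then show ?case by simp
next
  case (insert i I)
  have "F (\<lambda>b. (\<Sum>i\<in>I. c i * p i b) + c i * p i b) = F (\<lambda>b. \<Sum>i\<in>I. c i * p i b) + c i * F (p i)"
    by (rule linear_on_polysD[OF F]) (use insert in \<open>auto intro: polys_sum\<close>)
  then show ?case using insert by (simp add: add.commute)
qed

lemma linear_on_polys_mult:
  assumes "linear_on_polys N F" "q \<in> polys N"
  shows "linear_on_polys N (\<lambda>p. F (\<lambda>b. q b * p b))"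
  unfolding linear_on_polys_def
proof (intro ballI allI)
  fix p p' c assume "p \<in> polys N" "p' \<in> polys N"
  then have "F (\<lambda>b. q b * p b + c * (q b * p' b)) = F (\<lambda>b. q b * p b) + c * F (\<lambda>b. q b * p' b)"
    by (intro linear_on_polysD[OF assms(1)] polys_mult assms(2))
  then show "F (\<lambda>b. q b * (p b + c * p' b)) = F (\<lambda>b. q b * p b) + c * F (\<lambda>b. q b * p' b)"
    by (simp add: algebra_simps)
qed

text \<open>Peeling one factor off the power multiplies \<open>q\<close> by
  \<open>lin N (\<eta> l)\<close> and produces a variable \<open>x l\<close>; hence the induction
  ranges over all \<open>q\<close>.\<close>

lemma functional_of_linear_power_in_span_monom_funs:
  assumes F: "linear_on_polys N F" and "q \<in> polys N"
  shows "(\<lambda>x. F (\<lambda>b. q b * (\<Sum>l<N. x l * lin N (\<eta> l) b) ^ i)) \<in> fun_space.span (monom_funs N i)"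
  using assms(2)
proof (induction i arbitrary: q)
  case 0
  have "(\<lambda>x. 1) \<in> monom_funs N 0" by (auto simp: monom_funs_def)
  then have "(\<lambda>x. F q * 1) \<in> fun_space.span (monom_funs N 0)"
    using fun_space.span_scale[OF fun_space.span_base] by blast
  then show ?case by simp
next
  case (Suc i)
  let ?y = "\<lambda>x b. \<Sum>l<N. x l * lin N (\<eta> l) b"
  have y: "?y x \<in> polys N" for x by (intro polys_sum polys_lin)
  have "(\<lambda>x. \<Sum>l<N. x l * F (\<lambda>b. (q b * lin N (\<eta> l) b) * ?y x b ^ i)) \<in> fun_space.span (monom_funs N (Suc i))"
    by (intro span_monom_funs_Suc Suc.IH polys_mult polys_lin Suc.prems)
  also have "(\<lambda>x. \<Sum>l<N. x l * F (\<lambda>b. (q b * lin N (\<eta> l) b) * ?y x b ^ i)) = (\<lambda>x. F (\<lambda>b. q b * ?y x b ^ Suc i))"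
  proof
    fix x
    have "(\<Sum>l<N. x l * F (\<lambda>b. (q b * lin N (\<eta> l) b) * ?y x b ^ i))
        = F (\<lambda>b. \<Sum>l<N. x l * ((q b * lin N (\<eta> l) b) * ?y x b ^ i))"
      by (rule linear_on_polys_sum[OF F, symmetric])
         (use y in \<open>auto intro!: polys_mult polys_lin polys_power Suc.prems\<close>)
    also have "(\<lambda>b. \<Sum>l<N. x l * ((q b * lin N (\<eta> l) b) * ?y x b ^ i)) = (\<lambda>b. q b * ?y x b ^ Suc i)"
      by (rule ext) (simp add: sum_distrib_right sum_distrib_left mult_ac)
    finally show "(\<Sum>l<N. x l * F (\<lambda>b. (q b * lin N (\<eta> l) b) * ?y x b ^ i)) = F (\<lambda>b. q b * ?y x b ^ Suc i)" .
  qed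
  finally show ?case .
qed

section \<open>Functionals annihilated by products of linear forms\<close>

text \<open>Split a linear form \<open>x\<close> into \<open>lin N x \<beta>\<close> times
  \<open>z\<close> and a part \<open>y x\<close> vanishing at \<open>\<beta>\<close>. Powers of
  \<open>z\<close> act as 1 under \<open>F\<close>, and powers of \<open>y x\<close> are killed from
  exponent \<open>s\<close> on, so the binomial expansion leaves powers of
  \<open>lin N \<beta> x\<close> times forms of degree below \<open>s\<close>.\<close>

lemma power_sum_functional_one_point:
  assumes "d \<ge> 1" and F: "linear_on_polys N F"
    and unit: "\<And>p. p \<in> polys N \<Longrightarrow> F (\<lambda>b. lin N z b * p b) = F p"
    and z\<beta>: "lin N z \<beta> = 1"
    and kill: "\<And>w q. q \<in> polys N \<Longrightarrow> lin N w \<beta> = 0 \<Longrightarrow> F (\<lambda>b. lin N w b ^ s * q b) = 0"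
  shows "power_sum (range (lin N)) d (2 ^ (N + s) * d) (\<lambda>x. F (\<lambda>b. lin N x b ^ d))"
proof (rule power_sum_span_osculating[OF assms(1), where \<beta> = \<beta>])
  let ?U = "\<Union>i\<in>{i. i < s \<and> i \<le> d}. (\<lambda>p x. lin N \<beta> x ^ (d - i) * p x) ` monom_funs N i"
  \<comment> \<open>Projection along \<open>z\<close> onto the linear forms vanishing at
    \<open>\<beta>\<close>; \<open>\<eta> l\<close> is the image of coordinate \<open>l\<close>,
    which makes \<open>y x\<close> visibly linear in \<open>x\<close>.\<close>
  define y where "y x l = x l + (- lin N x \<beta>) * z l" for x l
  define \<eta> where "\<eta> l j = (if j = l then 1 else 0) + (- \<beta> l) * z j" for l j :: nat
  have liny: "lin N (y x) b = lin N x b + (- lin N x \<beta>) * lin N z b" for x b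
    unfolding y_def by (rule lin_add_scale)
  have y0: "lin N (y x) \<beta> = 0" for x
    by (simp add: liny z\<beta>)
  have lin\<eta>: "lin N (\<eta> l) b = b l + (- \<beta> l) * lin N z b" if "l < N" for l b
    unfolding \<eta>_def by (subst lin_add_scale) (simp add: lin_unit that)
  have y\<eta>: "lin N (y x) b = (\<Sum>l<N. x l * lin N (\<eta> l) b)" for x b
  proof -
    have "(\<Sum>l<N. x l * lin N (\<eta> l) b) = (\<Sum>l<N. x l * b l + (- lin N z b) * (x l * \<beta> l))"
      by (intro sum.cong) (auto simp: lin\<eta> algebra_simps)
    also have "\<dots> = lin N x b + (- lin N z b) * lin N x \<beta>"
      by (simp only: lin_def sum.distrib sum_distrib_left)
    finally show ?thesis by (simp add: liny)
  qed
  have unit_pow: "F (\<lambda>b. lin N z b ^ n * p b) = F p" if "p \<in> polys N" for n p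
  proof (induction n)
    case (Suc n)
    have "(\<lambda>b. lin N z b ^ n * p b) \<in> polys N"
      by (intro polys_mult polys_power polys_lin that)
    from unit[OF this] Suc show ?case by (simp add: mult.assoc)
  qed simp
  have eq: "F (\<lambda>b. lin N x b ^ d)
      = (\<Sum>i\<in>{i. i < s \<and> i \<le> d}. of_nat (d choose i) * (lin N \<beta> x ^ (d - i) * F (\<lambda>b. 1 * (\<Sum>l<N. x l * lin N (\<eta> l) b) ^ i)))" for x
  proof -
    have "(\<lambda>b. lin N x b ^ d) = (\<lambda>b. \<Sum>i\<le>d. (of_nat (d choose i) * lin N x \<beta> ^ (d - i)) *
        (lin N z b ^ (d - i) * lin N (y x) b ^ i))"
    proof
      fix b
      have "lin N x b = lin N (y x) b + lin N x \<beta> * lin N z b"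
        by (simp add: liny)
      then show "lin N x b ^ d = (\<Sum>i\<le>d. (of_nat (d choose i) * lin N x \<beta> ^ (d - i)) *
          (lin N z b ^ (d - i) * lin N (y x) b ^ i))"
        by (simp add: binomial_ring power_mult_distrib mult_ac)
    qed
    then have "F (\<lambda>b. lin N x b ^ d) = (\<Sum>i\<le>d. (of_nat (d choose i) * lin N x \<beta> ^ (d - i)) *
        F (\<lambda>b. lin N z b ^ (d - i) * lin N (y x) b ^ i))"
      using linear_on_polys_sum[OF F, of "{..d}"
        "\<lambda>i b. lin N z b ^ (d - i) * lin N (y x) b ^ i" "\<lambda>i. of_nat (d choose i) * lin N x \<beta> ^ (d - i)"]
      by (simp add: polys_mult polys_power polys_lin)
    also have "\<dots> = (\<Sum>i\<le>d. (of_nat (d choose i) * lin N x \<beta> ^ (d - i)) * F (\<lambda>b. lin N (y x) b ^ i))"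
      by (simp add: unit_pow polys_power polys_lin)
    also have "\<dots> = (\<Sum>i\<in>{i. i < s \<and> i \<le> d}. (of_nat (d choose i) * lin N x \<beta> ^ (d - i)) * F (\<lambda>b. lin N (y x) b ^ i))"
    proof (rule sum.mono_neutral_right)
      show "\<forall>i\<in>{..d} - {i. i < s \<and> i \<le> d}. (of_nat (d choose i) * lin N x \<beta> ^ (d - i)) * F (\<lambda>b. lin N (y x) b ^ i) = 0"
      proof
        fix i assume "i \<in> {..d} - {i. i < s \<and> i \<le> d}"
        then have "s \<le> i" by auto
        then have "(\<lambda>b. lin N (y x) b ^ i) = (\<lambda>b. lin N (y x) b ^ s * lin N (y x) b ^ (i - s))"
          by (simp add: power_add[symmetric])
        then show "(of_nat (d choose i) * lin N x \<beta> ^ (d - i)) * F (\<lambda>b. lin N (y x) b ^ i) = 0"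
          using kill[OF polys_power[OF polys_lin] y0] by simp
      qed
    qed auto
    finally show ?thesis
      by (simp add: y\<eta> lin_commute[of N x] mult.assoc)
  qed
  show "(\<lambda>x. F (\<lambda>b. lin N x b ^ d)) \<in> fun_space.span ?U"
    unfolding eq
  proof (rule span_sum_fun)
    fix i assume i: "i \<in> {i. i < s \<and> i \<le> d}"
    show "(\<lambda>x. lin N \<beta> x ^ (d - i) * F (\<lambda>b. 1 * (\<Sum>l<N. x l * lin N (\<eta> l) b) ^ i)) \<in> fun_space.span ?U"
      by (rule span_mult_left[OF functional_of_linear_power_in_span_monom_funs[OF F polys.one]])
         (use i in \<open>auto intro!: fun_space.span_base\<close>)
  qed
qed

text \<open>Induction on the number of nodes, for all functionals at once: multiplying
  \<open>F\<close> by a linear form that vanishes at one node yields a functional for the remaining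
  nodes. Each split doubles the count, which the exponent \<open>N + card K\<close> absorbs.\<close>

lemma power_sum_functional:
  assumes "d \<ge> 1" "finite K" "linear_on_polys N F"
    and "\<And>p. p \<in> polys N \<Longrightarrow> F (\<lambda>b. lin N z b * p b) = F p"
    and "\<And>k. k \<in> K \<Longrightarrow> lin N z (\<beta> k) = 1"
    and "\<And>w q. q \<in> polys N \<Longrightarrow> (\<And>k. k \<in> K \<Longrightarrow> lin N (w k) (\<beta> k) = 0)
           \<Longrightarrow> F (\<lambda>b. (\<Prod>k\<in>K. lin N (w k) b) * q b) = 0"
  shows "power_sum (range (lin N)) d (2 ^ (N + card K) * d) (\<lambda>x. F (\<lambda>b. lin N x b ^ d))"
  using assms(2-)
proof (induction "card K" arbitrary: K F)
  case 0
  \<comment> \<open>With no node left the empty product is killed, so \<open>F\<close> is zero on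
    polynomials.\<close>
  have "F (\<lambda>b. lin N x b ^ d) = 0" for x
    using 0(6)[of "\<lambda>b. lin N x b ^ d"] polys_power[OF polys_lin] 0(1,2) by auto
  then show ?case
    using power_sum_mono[OF power_sum_0 _ subspace_range_lin \<open>d \<ge> 1\<close>] by simp
next
  case (Suc s)
  note F = \<open>linear_on_polys N F\<close> and unit = Suc.prems(3) and z\<beta> = Suc.prems(4) and kill = Suc.prems(5)
  show ?case
  proof (cases "\<exists>i\<in>K. \<exists>j\<in>K. \<exists>l<N. \<beta> i l \<noteq> \<beta> j l")
    case False
    obtain k0 where k0: "k0 \<in> K" using Suc.hyps(2) by fastforce
    have same: "lin N w (\<beta> k) = lin N w (\<beta> k0)" if "k \<in> K" for k w
    proof -
      have "\<beta> k l = \<beta> k0 l" if "l < N" for l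
        using False \<open>k \<in> K\<close> k0 that by blast
      then show ?thesis unfolding lin_def by (intro sum.cong) simp_all
    qed
    show ?thesis
    proof (rule power_sum_functional_one_point[OF \<open>d \<ge> 1\<close> F unit z\<beta>[OF k0]])
      fix w q assume "q \<in> polys N" "lin N w (\<beta> k0) = 0"
      then show "F (\<lambda>b. lin N w b ^ card K * q b) = 0"
        using kill[of q "\<lambda>_. w"] same by simp
    qed
  next
    case True
    then obtain i j l where ij: "i \<in> K" "j \<in> K" "l < N" "\<beta> i l \<noteq> \<beta> j l" by blast
    \<comment> \<open>Scaling by \<open>D\<close> gives \<open>u\<close> the value 1 at
      \<open>\<beta> j\<close>, so that \<open>u'\<close>, the difference of \<open>z\<close> and
      \<open>u\<close>, vanishes there.\<close>
    define D where "D = 1 / (\<beta> j l - \<beta> i l)"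
    define e where "e m = (if m = l then 1 else 0 :: complex)" for m
    define u where "u m = (0 + D * e m) + (- D * \<beta> i l) * z m" for m
    define u' where "u' m = z m + (-1) * u m" for m
    have linu: "lin N u b = D * (b l - \<beta> i l * lin N z b)" for b
    proof -
      have "lin N u b = lin N (\<lambda>_. 0) b + D * lin N e b + (- D * \<beta> i l) * lin N z b"
        unfolding u_def by (simp only: lin_add_scale)
      also have "lin N e b = b l" unfolding e_def using ij(3) by (rule lin_unit)
      finally show ?thesis by (simp add: lin_def algebra_simps)
    qed
    have linu': "lin N u' b = lin N z b + (-1) * lin N u b" for b
      unfolding u'_def by (rule lin_add_scale)
    have vanish: "lin N u (\<beta> i) = 0" "lin N u' (\<beta> j) = 0"
      using ij(4) by (simp_all add: linu' linu z\<beta>[OF ij(1)] z\<beta>[OF ij(2)] D_def)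
    have half: "power_sum (range (lin N)) d (2 ^ (N + s) * d) (\<lambda>x. F (\<lambda>b. lin N v b * lin N x b ^ d))"
      if v: "lin N v (\<beta> k0) = 0" and k0: "k0 \<in> K" for v k0
    proof -
      have s: "s = card (K - {k0})" using k0 Suc.hyps(2) Suc.prems(1) by simp
      have "power_sum (range (lin N)) d (2 ^ (N + card (K - {k0})) * d) (\<lambda>x. (\<lambda>p. F (\<lambda>b. lin N v b * p b)) (\<lambda>b. lin N x b ^ d))"
      proof (rule Suc.hyps(1)[OF s])
        show "linear_on_polys N (\<lambda>p. F (\<lambda>b. lin N v b * p b))"
          by (rule linear_on_polys_mult[OF F polys_lin])
        show "F (\<lambda>b. lin N v b * (lin N z b * p b)) = F (\<lambda>b. lin N v b * p b)" if "p \<in> polys N" for p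
          using unit[OF polys.lin_mult[OF that, of v]] by (simp add: mult_ac)
        show "F (\<lambda>b. lin N v b * ((\<Prod>k\<in>K - {k0}. lin N (w k) b) * q b)) = 0"
          if q: "q \<in> polys N" and w: "\<And>k. k \<in> K - {k0} \<Longrightarrow> lin N (w k) (\<beta> k) = 0" for w q
        proof -
          \<comment> \<open>The form \<open>v\<close> takes the place of the missing factor at
            \<open>k0\<close>.\<close>
          have "F (\<lambda>b. (\<Prod>k\<in>K. lin N ((w(k0 := v)) k) b) * q b) = 0"
            by (rule kill[OF q]) (use w v in auto)
          moreover have "(\<Prod>k\<in>K. lin N ((w(k0 := v)) k) b) = lin N v b * (\<Prod>k\<in>K - {k0}. lin N (w k) b)" for b
            using k0 Suc.prems(1) by (simp add: prod.remove[of K k0])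
          ultimately show ?thesis by (simp add: mult.assoc)
        qed
      qed (use Suc.prems(1) z\<beta> in auto)
      then show ?thesis using s by simp
    qed
    \<comment> \<open>Since \<open>z\<close> acts as 1 under \<open>F\<close> and is the sum of
      \<open>u\<close> and \<open>u'\<close>, the two halves add up to \<open>F\<close>.\<close>
    have "F (\<lambda>b. lin N u b * lin N x b ^ d) + F (\<lambda>b. lin N u' b * lin N x b ^ d) = F (\<lambda>b. lin N x b ^ d)" for x
    proof -
      let ?p = "\<lambda>b. lin N x b ^ d"
      have p: "?p \<in> polys N" by (intro polys_power polys_lin)
      have "F ?p = F (\<lambda>b. lin N z b * ?p b)" using unit[OF p] by simp
      also have "(\<lambda>b. lin N z b * ?p b) = (\<lambda>b. lin N u b * ?p b + 1 * (lin N u' b * ?p b))"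
        by (simp add: linu' algebra_simps)
      also have "F \<dots> = F (\<lambda>b. lin N u b * ?p b) + 1 * F (\<lambda>b. lin N u' b * ?p b)"
        by (intro linear_on_polysD[OF F] polys.lin_mult p)
      finally show ?thesis by simp
    qed
    moreover have "2 ^ (N + s) * d + 2 ^ (N + s) * d = 2 ^ (N + card K) * d"
      using Suc.hyps(2)[symmetric] by simp
    ultimately show ?thesis
      using power_sum_add[OF half[OF vanish(1) ij(1)] half[OF vanish(2) ij(2)]] by (simp only:)
  qed
qed

section \<open>Limits of finitely supported functionals\<close>

lemma tendsto_lin:
  assumes "\<And>l. l < N \<Longrightarrow> (\<lambda>m. b m l) \<longlonglongrightarrow> \<beta> l"
  shows "(\<lambda>m. lin N w (b m)) \<longlonglongrightarrow> lin N w \<beta>"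
  unfolding lin_def by (intro tendsto_sum tendsto_mult tendsto_const assms) auto

lemma subspace_convergent_sums:
  fixes b :: "nat \<Rightarrow> nat \<Rightarrow> 'a"
  shows "fun_space.subspace {p. convergent (\<lambda>m. \<Sum>k<r. c m k * p (b m k))}"
proof (rule fun_space.subspaceI)
  show "0 \<in> {p. convergent (\<lambda>m. \<Sum>k<r. c m k * p (b m k))}"
    by (simp add: convergent_const)
  show "p + q \<in> {p. convergent (\<lambda>m. \<Sum>k<r. c m k * p (b m k))}"
    if "p \<in> {p. convergent (\<lambda>m. \<Sum>k<r. c m k * p (b m k))}"
      "q \<in> {p. convergent (\<lambda>m. \<Sum>k<r. c m k * p (b m k))}" for p q
    using that convergent_add by (fastforce simp: distrib_left sum.distrib)
  show "(\<lambda>x. a * p x) \<in> {p. convergent (\<lambda>m. \<Sum>k<r. c m k * p (b m k))}"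
    if "p \<in> {p. convergent (\<lambda>m. \<Sum>k<r. c m k * p (b m k))}" for a p
    using that convergent_mult[OF convergent_const[of a]]
    by (fastforce simp: sum_distrib_left mult.left_commute)
qed

section \<open>Weighted point evaluations at converging nodes\<close>

context
  fixes N r d :: nat and c :: "nat \<Rightarrow> nat \<Rightarrow> complex" and b :: "nat \<Rightarrow> nat \<Rightarrow> nat \<Rightarrow> complex"
    and \<beta> :: "nat \<Rightarrow> nat \<Rightarrow> complex" and z :: "nat \<Rightarrow> complex"
  assumes rd: "r \<le> d"
    and b_lim: "\<And>k l. k < r \<Longrightarrow> l < N \<Longrightarrow> (\<lambda>m. b m k l) \<longlonglongrightarrow> \<beta> k l"
    and z_b: "\<And>m k. k < r \<Longrightarrow> lin N z (b m k) = 1"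
    and conv_d: "\<And>x. convergent (\<lambda>m. \<Sum>k<r. c m k * lin N x (b m k) ^ d)"
begin

definition node_sum :: "nat \<Rightarrow> ((nat \<Rightarrow> complex) \<Rightarrow> complex) \<Rightarrow> complex" where
  "node_sum m p = (\<Sum>k<r. c m k * p (b m k))"

lemma node_sum_add_scale: "node_sum m (\<lambda>x. p x + a * q x) = node_sum m p + a * node_sum m q"
  by (simp add: node_sum_def sum.distrib sum_distrib_left algebra_simps)

lemma subspace_convergent: "fun_space.subspace {p. convergent (\<lambda>m. node_sum m p)}"
  unfolding node_sum_def by (rule subspace_convergent_sums)

text \<open>Pad the product with copies of \<open>z\<close> up to degree \<open>d\<close>, which
  changes no value at the nodes, and polarize into d-th powers, where convergence is
  assumed.\<close>

lemma convergent_short_product: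
  assumes "length ws \<le> d"
  shows "convergent (\<lambda>m. node_sum m (\<lambda>x. \<Prod>w\<leftarrow>ws. lin N w x))"
proof -
  define us where "us = map (lin N) (replicate (d - length ws) z @ ws)"
  have len: "length us = d" using assms by (simp add: us_def)
  have "(\<lambda>x. \<Prod>u\<leftarrow>us. u x) \<in> fun_space.span ((\<lambda>v x. v x ^ length us) ` range (lin N))"
    by (rule prod_list_in_span_powers[OF subspace_range_lin]) (auto simp: us_def)
  also have "\<dots> \<subseteq> {p. convergent (\<lambda>m. node_sum m p)}"
    by (rule fun_space.span_minimal[OF _ subspace_convergent]) (use conv_d len in \<open>auto simp: node_sum_def\<close>)
  finally have "convergent (\<lambda>m. node_sum m (\<lambda>x. \<Prod>u\<leftarrow>us. u x))" by simp
  moreover have "(\<Prod>u\<leftarrow>us. u (b m k)) = (\<Prod>w\<leftarrow>ws. lin N w (b m k))" if "k < r" for m k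
    using z_b[OF that] by (simp add: us_def o_def)
  ultimately show ?thesis by (simp add: node_sum_def)
qed

text \<open>The product of the factors \<open>lin N (w k) x - lin N (w k) (b m k)\<close> vanishes
  at every node. Expanding it over subsets \<open>X\<close> and isolating the full one expresses a
  product through shorter ones, with coefficients free of the weights \<open>c\<close>.\<close>

lemma expand_vanishing_product:
  fixes w :: "nat \<Rightarrow> nat \<Rightarrow> complex"
  shows "node_sum m (\<lambda>x. (\<Prod>k<r. lin N (w k) x) * q x) =
    - (\<Sum>X\<in>Pow {..<r} - {{..<r}}. (\<Prod>k\<in>{..<r} - X. - lin N (w k) (b m k)) *
          node_sum m (\<lambda>x. (\<Prod>k\<in>X. lin N (w k) x) * q x))"
proof -
  let ?t = "\<lambda>k. - lin N (w k) (b m k)"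
  have "0 = node_sum m (\<lambda>x. (\<Prod>k<r. lin N (w k) x + ?t k) * q x)"
    unfolding node_sum_def by (rule sum.neutral[symmetric]) (auto simp: prod_zero_iff)
  also have "\<dots> = (\<Sum>X\<in>Pow {..<r}. (\<Prod>k\<in>{..<r} - X. ?t k) *
      node_sum m (\<lambda>x. (\<Prod>k\<in>X. lin N (w k) x) * q x))"
    unfolding node_sum_def prod_add[OF finite_lessThan]
    by (simp add: sum_distrib_left sum_distrib_right) (subst sum.swap, simp add: mult_ac)
  also have "\<dots> = node_sum m (\<lambda>x. (\<Prod>k<r. lin N (w k) x) * q x) +
      (\<Sum>X\<in>Pow {..<r} - {{..<r}}. (\<Prod>k\<in>{..<r} - X. ?t k) *
          node_sum m (\<lambda>x. (\<Prod>k\<in>X. lin N (w k) x) * q x))"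
    by (subst sum.remove[of _ "{..<r}"]) auto
  finally show ?thesis by (simp add: eq_neg_iff_add_eq_0)
qed

text \<open>The weights \<open>c m k\<close> may diverge, so convergence is transported through the
  sums. Strong induction on the number of factors: when there are more than \<open>d\<close>, the
  first \<open>r\<close> can be rewritten by shorter products, whose coefficients converge along
  with the nodes.\<close>

lemma convergent_product:
  "convergent (\<lambda>m. node_sum m (\<lambda>x. \<Prod>w\<leftarrow>ws. lin N w x))"
proof (induction "length ws" arbitrary: ws rule: less_induct)
  case less
  show ?case
  proof (cases "length ws \<le> d")
    case True
    then show ?thesis by (rule convergent_short_product)
  next
    case False
    then have r: "r \<le> length ws" using rd by simp
    let ?q = "\<lambda>x. \<Prod>w\<leftarrow>drop r ws. lin N w x"
    have "take r ws = map (\<lambda>k. ws ! k) [0..<r]"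
      using r by (intro nth_equalityI) auto
    then have "(\<Prod>w\<leftarrow>take r ws. lin N w x) = (\<Prod>k<r. lin N (ws ! k) x)" for x
      by (simp add: o_def prod.distinct_set_conv_list[symmetric] lessThan_atLeast0)
    then have eq: "(\<Prod>w\<leftarrow>ws. lin N w x) = (\<Prod>k<r. lin N (ws ! k) x) * ?q x" for x
      by (metis append_take_drop_id map_append prod_list.append)
    have smaller: "convergent (\<lambda>m. node_sum m (\<lambda>x. (\<Prod>k\<in>X. lin N (ws ! k) x) * ?q x))"
      if "X \<in> Pow {..<r} - {{..<r}}" for X
    proof -
      have X: "finite X" "card X < r"
        using that psubset_card_mono[of "{..<r}" X] by (auto intro: finite_subset)
      let ?ws = "map (\<lambda>k. ws ! k) (sorted_list_of_set X) @ drop r ws"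
      have "convergent (\<lambda>m. node_sum m (\<lambda>x. \<Prod>w\<leftarrow>?ws. lin N w x))"
        by (rule less) (use X r in auto)
      moreover have "(\<Prod>w\<leftarrow>?ws. lin N w x) = (\<Prod>k\<in>X. lin N (ws ! k) x) * ?q x" for x
        using prod.distinct_set_conv_list[of "sorted_list_of_set X" "\<lambda>k. lin N (ws ! k) x"] X(1)
        by (simp add: o_def)
      ultimately show ?thesis by (simp only:)
    qed
    have t: "convergent (\<lambda>m. \<Prod>k\<in>{..<r} - X. - lin N (ws ! k) (b m k))" for X
      by (rule convergentI[where L = "\<Prod>k\<in>{..<r} - X. - lin N (ws ! k) (\<beta> k)"],
          intro tendsto_prod tendsto_minus tendsto_lin b_lim) auto
    show ?thesis
      unfolding eq expand_vanishing_product
      by (subst convergent_minus_iff[symmetric], intro convergent_sum convergent_mult t smaller)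
  qed
qed

lemma convergent_polys:
  assumes "p \<in> polys N"
  shows "convergent (\<lambda>m. node_sum m p)"
proof -
  \<comment> \<open>The extra product collects the linear factors met in the induction on
    \<open>p\<close>.\<close>
  have "convergent (\<lambda>m. node_sum m (\<lambda>x. p x * (\<Prod>w\<leftarrow>ws. lin N w x)))" for ws
    using assms
  proof (induction arbitrary: ws rule: polys.induct)
    case one
    then show ?case using convergent_product by simp
  next
    case (lin_mult p w)
    from lin_mult.IH[of "w # ws"] show ?case by (simp add: mult_ac)
  next
    case (add_scale p q a)
    from subspace_add_fun[OF subspace_convergent, of "\<lambda>x. p x * (\<Prod>w\<leftarrow>ws. lin N w x)"
      "\<lambda>x. q x * (\<Prod>w\<leftarrow>ws. lin N w x)" a] add_scale.IH[of ws]
    show ?case by (simp add: algebra_simps)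
  qed
  from this[of "[]"] show ?thesis by simp
qed

text \<open>The limit functional meets the hypotheses of \<open>power_sum_functional\<close>:
  \<open>z\<close> is 1 at every node, and annihilation is the limit of
  \<open>expand_vanishing_product\<close>.\<close>

lemma power_sum_limit:
  assumes "d \<ge> 1"
  shows "power_sum (range (lin N)) d (2 ^ (N + r) * d)
    (\<lambda>x. lim (\<lambda>m. \<Sum>k<r. c m k * lin N x (b m k) ^ d))"
proof -
  define F where "F p = lim (\<lambda>m. node_sum m p)" for p
  have F_lim: "(\<lambda>m. node_sum m p) \<longlonglongrightarrow> F p" if "p \<in> polys N" for p
    using convergent_polys[OF that] unfolding F_def by (simp add: convergent_LIMSEQ_iff)
  have "power_sum (range (lin N)) d (2 ^ (N + card {..<r}) * d) (\<lambda>x. F (\<lambda>b. lin N x b ^ d))"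
  proof (rule power_sum_functional[where z = z and \<beta> = \<beta>])
    show "linear_on_polys N F"
      unfolding linear_on_polys_def
    proof (intro ballI allI)
      fix p q a assume "p \<in> polys N" "q \<in> polys N"
      then have "(\<lambda>m. node_sum m (\<lambda>x. p x + a * q x)) \<longlonglongrightarrow> F p + a * F q"
        unfolding node_sum_add_scale by (intro tendsto_intros F_lim)
      then show "F (\<lambda>x. p x + a * q x) = F p + a * F q"
        unfolding F_def by (rule limI)
    qed
    show "F (\<lambda>x. lin N z x * p x) = F p" for p
      by (simp add: F_def node_sum_def z_b)
    show "lin N z (\<beta> k) = 1" if "k \<in> {..<r}" for k
    proof (rule LIMSEQ_unique)
      show "(\<lambda>m. lin N z (b m k)) \<longlonglongrightarrow> lin N z (\<beta> k)"
        using that by (intro tendsto_lin b_lim) auto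
      show "(\<lambda>m. lin N z (b m k)) \<longlonglongrightarrow> 1"
        using that by (simp add: z_b)
    qed
    show "F (\<lambda>x. (\<Prod>k<r. lin N (w k) x) * q x) = 0"
      if q: "q \<in> polys N" and w: "\<And>k. k \<in> {..<r} \<Longrightarrow> lin N (w k) (\<beta> k) = 0" for w q
    proof -
      have poly: "(\<lambda>x. (\<Prod>k\<in>X. lin N (w k) x) * q x) \<in> polys N" for X
        by (intro polys_mult polys_prod polys_lin q)
      have "(\<lambda>m. (\<Prod>k\<in>{..<r} - X. - lin N (w k) (b m k)) *
          node_sum m (\<lambda>x. (\<Prod>k\<in>X. lin N (w k) x) * q x)) \<longlonglongrightarrow> 0"
        if X: "X \<in> Pow {..<r} - {{..<r}}" for X
      proof -
        have "(\<lambda>m. \<Prod>k\<in>{..<r} - X. - lin N (w k) (b m k)) \<longlonglongrightarrow> (\<Prod>k\<in>{..<r} - X. - lin N (w k) (\<beta> k))"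
          by (intro tendsto_prod tendsto_minus tendsto_lin b_lim) auto
        \<comment> \<open>A proper subset \<open>X\<close> leaves out some index, and the form of
          that index vanishes at its limit node.\<close>
        moreover have "(\<Prod>k\<in>{..<r} - X. - lin N (w k) (\<beta> k)) = 0"
          using X w by (subst prod_zero_iff) auto
        ultimately show ?thesis
          using tendsto_mult[OF _ F_lim[OF poly[of X]]] by fastforce
      qed
      then have "(\<lambda>m. - (\<Sum>X\<in>Pow {..<r} - {{..<r}}. (\<Prod>k\<in>{..<r} - X. - lin N (w k) (b m k)) *
          node_sum m (\<lambda>x. (\<Prod>k\<in>X. lin N (w k) x) * q x))) \<longlonglongrightarrow> - 0"
        by (intro tendsto_minus tendsto_null_sum)
      then show ?thesis
        using F_lim[OF poly[of "{..<r}"]] unfolding expand_vanishing_product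
        by (auto intro: LIMSEQ_unique)
    qed
  qed (use assms in auto)
  then show ?thesis by (simp add: F_def node_sum_def)
qed

end

section \<open>Rescaling powers to nodes in an affine hyperplane\<close>

lemma bounded_family_convergent_subsequence:
  fixes X :: "'j \<Rightarrow> nat \<Rightarrow> complex"
  assumes "finite J" "\<And>j m. j \<in> J \<Longrightarrow> norm (X j m) \<le> 1"
  obtains \<sigma> :: "nat \<Rightarrow> nat" where "strict_mono \<sigma>" "\<And>j. j \<in> J \<Longrightarrow> convergent (\<lambda>m. X j (\<sigma> m))"
proof -
  have "\<exists>\<sigma> :: nat \<Rightarrow> nat. strict_mono \<sigma> \<and> (\<forall>j\<in>J. convergent (\<lambda>m. X j (\<sigma> m)))"
    using assms
  proof (induction J rule: finite_induct)
    case empty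
    show ?case by (rule exI[of _ id]) (simp add: strict_mono_def)
  next
    case (insert j J)
    then obtain \<sigma> :: "nat \<Rightarrow> nat" where \<sigma>: "strict_mono \<sigma>" "\<forall>j\<in>J. convergent (\<lambda>m. X j (\<sigma> m))"
      by auto
    have "\<forall>m. X j (\<sigma> m) \<in> cball 0 1" using insert.prems by simp
    then obtain l \<rho> where \<rho>: "strict_mono (\<rho> :: nat \<Rightarrow> nat)" "((\<lambda>m. X j (\<sigma> m)) \<circ> \<rho>) \<longlonglongrightarrow> l"
      using compact_cball[of "0::complex" 1] unfolding compact_eq_seq_compact_metric seq_compact_def by metis
    have "convergent (\<lambda>m. X i (\<sigma> (\<rho> m)))" if "i \<in> insert j J" for i
    proof (cases "i = j")
      case True
      then show ?thesis using \<rho>(2) by (auto simp: convergent_def o_def)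
    next
      case False
      then show ?thesis
        using that \<sigma>(2) convergent_subseq_convergent[OF _ \<rho>(1), of "\<lambda>m. X i (\<sigma> m)"] by (auto simp: o_def)
    qed
    then show ?case
      using strict_mono_o[OF \<sigma>(1) \<rho>(1)] by (intro exI[of _ "\<sigma> \<circ> \<rho>"]) (auto simp: o_def)
  qed
  with that show ?thesis by blast
qed

text \<open>Take \<open>z\<close> on the moment curve with entries \<open>t ^ l\<close>: each
  \<open>\<alpha> k\<close> turns the pairing into a nonzero polynomial in \<open>t\<close>, and
  finitely many roots can be avoided.\<close>

lemma exists_nonvanishing_linear_form:
  assumes "finite K" "\<And>k. k \<in> K \<Longrightarrow> \<exists>l<N. \<alpha> k l \<noteq> 0"
  obtains z where "\<And>k. k \<in> K \<Longrightarrow> lin N z (\<alpha> k) \<noteq> 0"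
proof -
  have "finite {t. lin N (\<lambda>l. t ^ l) (\<alpha> k) = 0}" if k: "k \<in> K" for k
  proof -
    obtain l where l: "l < N" "\<alpha> k l \<noteq> 0" using assms(2)[OF k] by blast
    have "{..<N} = {..N - 1}" using l(1) by auto
    then have "{t. lin N (\<lambda>l. t ^ l) (\<alpha> k) = 0} = {t. (\<Sum>i\<le>N - 1. \<alpha> k i * t ^ i) = 0}"
      by (simp add: lin_def mult.commute)
    also have "finite \<dots>"
      by (rule polyfun_roots_finite[of _ l]) (use l in auto)
    finally show ?thesis .
  qed
  then have "finite (\<Union>k\<in>K. {t. lin N (\<lambda>l. t ^ l) (\<alpha> k) = 0})"
    using assms(1) by blast
  then obtain t where "t \<notin> (\<Union>k\<in>K. {t. lin N (\<lambda>l. t ^ l) (\<alpha> k) = 0})"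
    using ex_new_if_finite[OF infinite_UNIV_char_0] by blast
  then show ?thesis using that[of "\<lambda>l. t ^ l"] by blast
qed

text \<open>The powers may diverge individually, so length and direction are separated: the
  directions converge along a subsequence, and the lengths go into the weights
  \<open>c\<close>.\<close>

lemma power_sum_limit_of_powers:
  assumes "N \<ge> 1" "d \<ge> 1" "r \<le> d"
    and lim: "\<And>x. (\<lambda>m. \<Sum>k<r. lin N x (a m k) ^ d) \<longlonglongrightarrow> g x"
  shows "power_sum (range (lin N)) d (2 ^ (N + r) * d) g"
proof -
  define nrm where "nrm m k = (\<Sum>l<N. norm (a m k l))" for m k
  \<comment> \<open>The default direction for a vanishing vector keeps every norm sum equal to 1;
    index 0 is admissible as \<open>N \<ge> 1\<close>.\<close>
  define u where "u m k l = (if nrm m k = 0 then if l = 0 then 1 else 0 else a m k l / of_real (nrm m k))" for m k l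
  have nrm_ge: "nrm m k \<ge> 0" for m k by (simp add: nrm_def sum_nonneg)
  have u_norm: "(\<Sum>l<N. norm (u m k l)) = 1" for m k
  proof (cases "nrm m k = 0")
    case True
    then have "(\<Sum>l<N. norm (u m k l)) = (\<Sum>l<N. if l = 0 then 1 else 0)"
      by (intro sum.cong) (auto simp: u_def)
    then show ?thesis using assms(1) by simp
  next
    case False
    have "(\<Sum>l<N. norm (u m k l)) = (\<Sum>l<N. norm (a m k l) / nrm m k)"
      using False nrm_ge[of m k] by (intro sum.cong) (auto simp: u_def norm_divide)
    then show ?thesis
      using False by (simp add: sum_divide_distrib[symmetric]) (simp add: nrm_def)
  qed
  have u_le: "norm (u m k l) \<le> 1" if "l < N" for m k l
    using member_le_sum[of l "{..<N}" "\<lambda>l. norm (u m k l)"] that u_norm[of m k] by auto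
  have au: "a m k l = of_real (nrm m k) * u m k l" if "l < N" for m k l
  proof (cases "nrm m k = 0")
    case True
    then have "norm (a m k l) = 0"
      using that unfolding nrm_def by (subst (asm) sum_nonneg_eq_0_iff) auto
    then show ?thesis using True by simp
  qed (simp add: u_def)
  have lin_au: "lin N x (a m k) = of_real (nrm m k) * lin N x (u m k)" for x m k
    by (simp add: lin_def au sum_distrib_left mult_ac)
  obtain \<sigma> :: "nat \<Rightarrow> nat" where \<sigma>: "strict_mono \<sigma>"
    "\<And>j. j \<in> {..<r} \<times> {..<N} \<Longrightarrow> convergent (\<lambda>m. (\<lambda>(k, l) m. u m k l) j (\<sigma> m))"
    by (rule bounded_family_convergent_subsequence[of "{..<r} \<times> {..<N}" "\<lambda>(k, l) m. u m k l"])
       (auto simp: u_le)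
  define \<alpha> where "\<alpha> k l = lim (\<lambda>m. u (\<sigma> m) k l)" for k l
  have \<alpha>: "(\<lambda>m. u (\<sigma> m) k l) \<longlonglongrightarrow> \<alpha> k l" if "k < r" "l < N" for k l
    using \<sigma>(2)[of "(k, l)"] that by (simp add: \<alpha>_def convergent_LIMSEQ_iff)
  \<comment> \<open>The norm sum 1 passes to the limit, so no limiting direction vanishes.\<close>
  have "\<exists>l<N. \<alpha> k l \<noteq> 0" if k: "k \<in> {..<r}" for k
  proof (rule ccontr)
    assume "\<not> (\<exists>l<N. \<alpha> k l \<noteq> 0)"
    then have "(\<Sum>l<N. norm (\<alpha> k l)) = 0" by simp
    moreover have "(\<lambda>m. \<Sum>l<N. norm (u (\<sigma> m) k l)) \<longlonglongrightarrow> (\<Sum>l<N. norm (\<alpha> k l))"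
      using k by (intro tendsto_sum tendsto_norm \<alpha>) auto
    ultimately show False by (simp add: u_norm LIMSEQ_const_iff)
  qed
  then obtain z where z: "\<And>k. k \<in> {..<r} \<Longrightarrow> lin N z (\<alpha> k) \<noteq> 0"
    using exists_nonvanishing_linear_form[of "{..<r}"] by blast
  have "eventually (\<lambda>m. \<forall>k\<in>{..<r}. lin N z (u (\<sigma> m) k) \<noteq> 0) sequentially"
  proof (rule eventually_ball_finite)
    show "\<forall>k\<in>{..<r}. eventually (\<lambda>m. lin N z (u (\<sigma> m) k) \<noteq> 0) sequentially"
    proof
      fix k assume k: "k \<in> {..<r}"
      then have "(\<lambda>m. lin N z (u (\<sigma> m) k)) \<longlonglongrightarrow> lin N z (\<alpha> k)"
        by (intro tendsto_lin \<alpha>) auto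
      then show "eventually (\<lambda>m. lin N z (u (\<sigma> m) k) \<noteq> 0) sequentially"
        by (rule tendsto_imp_eventually_ne[OF _ z[OF k]])
    qed
  qed auto
  then obtain m0 where m0: "\<And>m k. m \<ge> m0 \<Longrightarrow> k < r \<Longrightarrow> lin N z (u (\<sigma> m) k) \<noteq> 0"
    unfolding eventually_sequentially by auto
  \<comment> \<open>Dropping the first \<open>m0\<close> terms makes \<open>z\<close> nonzero at all
    directions, so that its value can be divided out.\<close>
  define \<tau> where "\<tau> m = \<sigma> (m + m0)" for m
  have sub: "(\<lambda>m. X (\<tau> m)) \<longlonglongrightarrow> L" if "(\<lambda>m. X (\<sigma> m)) \<longlonglongrightarrow> L" for X and L :: complex
    using LIMSEQ_ignore_initial_segment[OF that, of m0] by (simp add: \<tau>_def)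
  have znz: "lin N z (u (\<tau> m) k) \<noteq> 0" if "k < r" for m k
    using m0[OF _ that] by (simp add: \<tau>_def)
  define b where "b m k l = (1 / lin N z (u (\<tau> m) k)) * u (\<tau> m) k l" for m k l
  \<comment> \<open>By homogeneity the factor divided out of the node returns as a d-th power,
    together with the length.\<close>
  define c where "c m k = (of_real (nrm (\<tau> m) k) * lin N z (u (\<tau> m) k)) ^ d" for m k
  have lin_b: "lin N x (b m k) = lin N x (u (\<tau> m) k) / lin N z (u (\<tau> m) k)" for x m k
    by (simp add: lin_def b_def sum_divide_distrib)
  have cb: "c m k * lin N x (b m k) ^ d = lin N x (a (\<tau> m) k) ^ d" if "k < r" for x m k
    using znz[OF that, of m] by (simp add: c_def lin_b lin_au power_mult_distrib power_divide)
  have g: "(\<lambda>m. \<Sum>k<r. c m k * lin N x (b m k) ^ d) \<longlonglongrightarrow> g x" for x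
    using sub[OF LIMSEQ_subseq_LIMSEQ[OF lim[of x] \<sigma>(1), unfolded o_def]] by (simp add: cb)
  have "power_sum (range (lin N)) d (2 ^ (N + r) * d)
      (\<lambda>x. lim (\<lambda>m. \<Sum>k<r. c m k * lin N x (b m k) ^ d))"
  proof (rule power_sum_limit[OF \<open>r \<le> d\<close>, where z = z and \<beta> = "\<lambda>k l. (1 / lin N z (\<alpha> k)) * \<alpha> k l"])
    show "(\<lambda>m. b m k l) \<longlonglongrightarrow> 1 / lin N z (\<alpha> k) * \<alpha> k l" if "k < r" "l < N" for k l
      unfolding b_def by (intro tendsto_mult tendsto_divide tendsto_const tendsto_lin sub \<alpha> that) (use z that in auto)
    show "lin N z (b m k) = 1" if "k < r" for m k
      using znz[OF that] by (simp add: lin_b)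
    show "convergent (\<lambda>m. \<Sum>k<r. c m k * lin N x (b m k) ^ d)" for x
      using g[of x] by (auto simp: convergent_def)
  qed (rule assms(2))
  moreover have "lim (\<lambda>m. \<Sum>k<r. c m k * lin N x (b m k) ^ d) = g x" for x
    using g by (rule limI)
  ultimately show ?thesis by simp
qed

section \<open>Essential variables\<close>

text \<open>Gaussian elimination: a pivot \<open>p\<close> of the last equation is removed from the
  others, which leaves \<open>r\<close> equations in more than \<open>r\<close> unknowns.\<close>

lemma underdetermined_system_nontrivial:
  fixes a :: "nat \<Rightarrow> 'i \<Rightarrow> complex"
  assumes "finite I" "card I > r"
  shows "\<exists>w. (\<exists>i\<in>I. w i \<noteq> 0) \<and> (\<forall>k<r. (\<Sum>i\<in>I. w i * a k i) = 0)"
  using assms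
proof (induction r arbitrary: I a)
  case 0
  then have "I \<noteq> {}" by auto
  then show ?case by (intro exI[of _ "\<lambda>_. 1"]) auto
next
  case (Suc r)
  show ?case
  proof (cases "\<exists>p\<in>I. a r p \<noteq> 0")
    case False
    then obtain w where "\<exists>i\<in>I. w i \<noteq> 0" "\<forall>k<r. (\<Sum>i\<in>I. w i * a k i) = 0"
      using Suc.IH[of I a] Suc.prems by auto
    with False show ?thesis by (intro exI[of _ w]) (auto simp: less_Suc_eq)
  next
    case True
    then obtain p where p: "p \<in> I" "a r p \<noteq> 0" by blast
    have "r < card (I - {p})" using Suc.prems p(1) by simp
    then obtain w where w: "\<exists>i\<in>I - {p}. w i \<noteq> 0"
      "\<And>k. k < r \<Longrightarrow> (\<Sum>i\<in>I - {p}. w i * (a k i - a k p / a r p * a r i)) = 0"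
      using Suc.IH[of "I - {p}" "\<lambda>k i. a k i - a k p / a r p * a r i"] Suc.prems(1) by blast
    define s where "s = (\<Sum>i\<in>I - {p}. w i * a r i)"
    \<comment> \<open>The value at \<open>p\<close> is forced by the last equation.\<close>
    define w' where "w' = w(p := - s / a r p)"
    have sum: "(\<Sum>i\<in>I. w' i * a k i) = - s / a r p * a k p + (\<Sum>i\<in>I - {p}. w i * a k i)" for k
      using p(1) Suc.prems(1) by (simp add: sum.remove[of I p] w'_def)
    have "(\<Sum>i\<in>I. w' i * a k i) = 0" if k: "k < Suc r" for k
    proof (cases "k = r")
      case True
      then show ?thesis using p(2) unfolding sum by (simp add: s_def)
    next
      case False
      then have "k < r" using k by simp
      from w(2)[OF this] have "(\<Sum>i\<in>I - {p}. w i * a k i) = a k p / a r p * s"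
        by (simp add: s_def sum_distrib_left right_diff_distrib sum_subtractf mult_ac)
      then show ?thesis unfolding sum by simp
    qed
    moreover have "\<exists>i\<in>I. w' i \<noteq> 0" using w(1) by (auto simp: w'_def)
    ultimately show ?thesis by blast
  qed
qed

section \<open>Linear forms on the original space\<close>

lemma lin_form_commute: "lin_form a x = lin_form x a"
  by (simp add: lin_form_def mult.commute)

lemma lin_form_add_scale: "lin_form a (x + c *s y) = lin_form a x + c * lin_form a y"
  by (simp add: lin_form_def sum.distrib sum_distrib_left algebra_simps)

lemma lin_form_axis: "lin_form (axis i 1) x = x $ i"
  by (simp add: lin_form_def axis_def if_distrib[of "\<lambda>x. x * _"] cong: if_cong)

lemma lin_form_sum_scale: "lin_form a (\<Sum>l\<in>L. w l *s e l) = (\<Sum>l\<in>L. w l * lin_form a (e l))"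
proof (induction L rule: infinite_finite_induct)
  case (insert l L)
  then show ?case using lin_form_add_scale[of a "\<Sum>l\<in>L. w l *s e l" "w l" "e l"] by (simp add: add.commute)
qed (auto simp: lin_form_def)

lemma subspace_range_lin_form: "fun_space.subspace (range (lin_form :: complex^'n::finite \<Rightarrow> _))"
proof (rule fun_space.subspaceI)
  show "0 \<in> range (lin_form :: complex^'n \<Rightarrow> _)"
    by (rule range_eqI[of _ _ 0]) (simp add: fun_eq_iff lin_form_def)
next
  fix p q assume "p \<in> range (lin_form :: complex^'n \<Rightarrow> _)" "q \<in> range (lin_form :: complex^'n \<Rightarrow> _)"
  then obtain u v :: "complex^'n" where "p = lin_form u" "q = lin_form v" by auto
  then show "p + q \<in> range lin_form"
    by (intro range_eqI[of _ _ "u + v"]) (simp add: fun_eq_iff lin_form_def sum.distrib algebra_simps)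
next
  fix c p assume "p \<in> range (lin_form :: complex^'n \<Rightarrow> _)"
  then obtain u :: "complex^'n" where "p = lin_form u" by auto
  then show "(\<lambda>x. c * p x) \<in> range lin_form"
    by (intro range_eqI[of _ _ "c *s u"]) (simp add: fun_eq_iff lin_form_def sum_distrib_left mult.assoc)
qed

lemma power_sum_range_lin_form_iff: "power_sum (range lin_form) d n f \<longleftrightarrow> waring_decomp d f n"
proof
  assume "power_sum (range lin_form) d n f"
  then obtain v where v: "\<forall>k<n. v k \<in> range lin_form" "f = (\<lambda>x. \<Sum>k<n. v k x ^ d)"
    unfolding power_sum_def by blast
  then have "\<forall>k. \<exists>a. k < n \<longrightarrow> v k = lin_form a" by blast
  then obtain a where "\<And>k. k < n \<Longrightarrow> v k = lin_form (a k)" by metis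
  then show "waring_decomp d f n" using v(2) by (auto simp: waring_decomp_def)
next
  assume "waring_decomp d f n"
  then obtain a where "f = (\<lambda>x. \<Sum>k<n. lin_form (a k) x ^ d)"
    unfolding waring_decomp_def by blast
  then show "power_sum (range lin_form) d n f"
    unfolding power_sum_def by (intro exI[of _ "\<lambda>k. lin_form (a k)"]) simp
qed

text \<open>Each monomial is a product of coordinate forms, to which polarization applies.\<close>

lemma homog_form_in_span_powers:
  fixes f :: "complex^'n::finite \<Rightarrow> complex"
  assumes "homog_form d f"
  shows "f \<in> fun_space.span ((\<lambda>v x. v x ^ d) ` range lin_form)"
proof -
  obtain c where f: "\<And>x. f x = (\<Sum>\<alpha>\<in>monomial_exps d. c \<alpha> * (\<Prod>i\<in>UNIV. (x $ i) ^ \<alpha> i))"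
    using assms unfolding homog_form_def by blast
  have list: "\<exists>us. set us \<subseteq> range lin_form \<and> length us = sum \<alpha> A \<and>
      (\<forall>x. (\<Prod>u\<leftarrow>us. u x) = (\<Prod>i\<in>A. x $ i ^ \<alpha> i))" for \<alpha> :: "'n \<Rightarrow> nat" and A :: "'n set"
    using finite[of A]
  proof (induction A rule: finite_induct)
    case (insert i A)
    then obtain us :: "(complex^'n \<Rightarrow> complex) list" where us: "set us \<subseteq> range lin_form"
      "length us = sum \<alpha> A" "\<And>x. (\<Prod>u\<leftarrow>us. u x) = (\<Prod>i\<in>A. x $ i ^ \<alpha> i)" by blast
    then show ?case
      using insert.hyps
      by (intro exI[of _ "replicate (\<alpha> i) (lin_form (axis i 1)) @ us"]) (auto simp: lin_form_axis)
  qed simp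
  have "(\<lambda>x. \<Sum>\<alpha>\<in>monomial_exps d. c \<alpha> * (\<Prod>i\<in>UNIV. (x $ i) ^ \<alpha> i))
      \<in> fun_space.span ((\<lambda>v x. v x ^ d) ` range lin_form)"
  proof (rule span_sum_fun)
    fix \<alpha> :: "'n \<Rightarrow> nat" assume \<alpha>: "\<alpha> \<in> monomial_exps d"
    obtain us :: "(complex^'n \<Rightarrow> complex) list" where us: "set us \<subseteq> range lin_form"
      "length us = sum \<alpha> UNIV" "\<And>x. (\<Prod>u\<leftarrow>us. u x) = (\<Prod>i\<in>UNIV. x $ i ^ \<alpha> i)"
      using list[of \<alpha> UNIV] by blast
    show "(\<lambda>x. \<Prod>i\<in>UNIV. (x $ i) ^ \<alpha> i) \<in> fun_space.span ((\<lambda>v x. v x ^ d) ` range lin_form)"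
      using prod_list_in_span_powers[OF subspace_range_lin_form us(1)] us(2,3) \<alpha>
      by (simp add: monomial_exps_def)
  qed
  then show ?thesis by (simp add: f[abs_def])
qed

text \<open>Pointwise convergence of functions need not survive a moving argument. For forms it
  controls all coefficients, by polarization, and finitely many of them are combined with converging
  coordinates.\<close>

lemma tendsto_power_sums_moving_point:
  fixes A :: "nat \<Rightarrow> nat \<Rightarrow> complex^'n::finite"
  assumes lim: "\<And>x. (\<lambda>m. \<Sum>k<r. lin_form (A m k) x ^ d) \<longlonglongrightarrow> f x"
    and y: "y \<longlonglongrightarrow> y0"
  shows "(\<lambda>m. \<Sum>k<r. lin_form (A m k) (y m) ^ d) \<longlonglongrightarrow> f y0"
proof -
  let ?P = "\<lambda>js a. \<Prod>j\<leftarrow>js. a $ j :: complex"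
  have expand: "(\<Sum>k<r. ?P js (A m k) * lin_form (A m k) x ^ Suc i)
      = (\<Sum>j\<in>UNIV. x $ j * (\<Sum>k<r. ?P (j # js) (A m k) * lin_form (A m k) x ^ i))" for js m x i
  proof -
    have "(\<Sum>k<r. ?P js (A m k) * lin_form (A m k) x ^ Suc i)
        = (\<Sum>k<r. \<Sum>j\<in>UNIV. x $ j * (?P (j # js) (A m k) * lin_form (A m k) x ^ i))"
      by (subst power_Suc, subst (1) lin_form_def)
         (simp add: sum_distrib_left sum_distrib_right mult_ac)
    also have "\<dots> = (\<Sum>j\<in>UNIV. x $ j * (\<Sum>k<r. ?P (j # js) (A m k) * lin_form (A m k) x ^ i))"
      by (subst sum.swap) (simp add: sum_distrib_left)
    finally show ?thesis .
  qed
  \<comment> \<open>The list \<open>js\<close> records the coordinates already split off. At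
    \<open>i = 0\<close> both sums are the same moment of the vectors \<open>A m k\<close>, which
    converges by polarization.\<close>
  have "length js + i = d \<Longrightarrow> \<exists>L. (\<lambda>m. \<Sum>k<r. ?P js (A m k) * lin_form (A m k) (y m) ^ i) \<longlonglongrightarrow> L
      \<and> (\<lambda>m. \<Sum>k<r. ?P js (A m k) * lin_form (A m k) y0 ^ i) \<longlonglongrightarrow> L" for js i
  proof (induction i arbitrary: js)
    case 0
    define us :: "(complex^'n \<Rightarrow> complex) list" where "us = map (\<lambda>j. lin_form (axis j 1)) js"
    have len: "length us = d" using 0 by (simp add: us_def)
    have "(\<lambda>x. \<Prod>u\<leftarrow>us. u x) \<in> fun_space.span ((\<lambda>v x. v x ^ length us) ` range lin_form)"
      by (rule prod_list_in_span_powers[OF subspace_range_lin_form]) (auto simp: us_def)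
    also have "\<dots> \<subseteq> {p. convergent (\<lambda>m. \<Sum>k<r. 1 * p (A m k))}"
      by (rule fun_space.span_minimal[OF _ subspace_convergent_sums])
         (auto simp: len lin_form_commute[of _ "A _ _"] intro!: convergentI[OF lim])
    finally show ?case by (simp add: us_def o_def lin_form_axis convergent_def)
  next
    case (Suc i)
    have "\<exists>L. \<forall>j. (\<lambda>m. \<Sum>k<r. ?P (j # js) (A m k) * lin_form (A m k) (y m) ^ i) \<longlonglongrightarrow> L j
      \<and> (\<lambda>m. \<Sum>k<r. ?P (j # js) (A m k) * lin_form (A m k) y0 ^ i) \<longlonglongrightarrow> L j"
      by (intro choice allI Suc.IH) (use Suc.prems in simp)
    then obtain L where L: "\<And>j. (\<lambda>m. \<Sum>k<r. ?P (j # js) (A m k) * lin_form (A m k) (y m) ^ i) \<longlonglongrightarrow> L j"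
      "\<And>j. (\<lambda>m. \<Sum>k<r. ?P (j # js) (A m k) * lin_form (A m k) y0 ^ i) \<longlonglongrightarrow> L j"
      by blast
    show ?case
      unfolding expand
      by (rule exI[of _ "\<Sum>j\<in>UNIV. y0 $ j * L j"])
         (intro conjI tendsto_sum tendsto_mult tendsto_const L tendsto_vec_nth y)
  qed
  from this[of "[]" d] obtain L where "(\<lambda>m. \<Sum>k<r. lin_form (A m k) (y m) ^ d) \<longlonglongrightarrow> L"
    "(\<lambda>m. \<Sum>k<r. lin_form (A m k) y0 ^ d) \<longlonglongrightarrow> L" by auto
  with LIMSEQ_unique[OF lim[of y0]] show ?thesis by simp
qed

section \<open>Reduction to at most \<open>r\<close> essential variables\<close>

context
  fixes A :: "nat \<Rightarrow> nat \<Rightarrow> complex^'n::finite" and f :: "complex^'n \<Rightarrow> complex" and r d :: nat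
  assumes lim: "\<And>x. (\<lambda>m. \<Sum>k<r. lin_form (A m k) x ^ d) \<longlonglongrightarrow> f x"
begin

text \<open>The codimension of this space is the number of essential variables of
  \<open>f\<close>.\<close>

definition invariant_directions :: "(complex^'n) set" where
  "invariant_directions = {v. \<forall>x c. f (x + c *s v) = f x}"

lemma subspace_invariant_directions: "vec.subspace invariant_directions"
proof (rule vec.subspaceI)
  show "u + v \<in> invariant_directions" if "u \<in> invariant_directions" "v \<in> invariant_directions" for u v
  proof -
    have "f (x + c *s (u + v)) = f x" for x c
    proof -
      have "f (x + c *s (u + v)) = f ((x + c *s u) + c *s v)"
        by (simp add: vec.scale_right_distrib add.assoc)
      also have "\<dots> = f x" using that by (simp add: invariant_directions_def)
      finally show ?thesis .
    qed
    then show ?thesis by (simp add: invariant_directions_def)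
  qed
qed (auto simp: invariant_directions_def)

text \<open>For each \<open>m\<close>, more than \<open>r\<close> coordinates against
  \<open>r\<close> equations leave a unit vector supported on \<open>I\<close> along which the
  \<open>m\<close>-th sum is constant. A limit point of these vectors works for \<open>f\<close>,
  and unit length keeps it nonzero.\<close>

lemma invariant_direction_supported_on:
  assumes "card I > r"
  shows "\<exists>v\<in>invariant_directions. v \<noteq> 0 \<and> (\<forall>i. i \<notin> I \<longrightarrow> v $ i = 0)"
proof -
  have "\<exists>v. norm v = 1 \<and> (\<forall>i. i \<notin> I \<longrightarrow> v $ i = 0) \<and> (\<forall>k<r. lin_form (A m k) v = 0)" for m
  proof -
    obtain w where w: "\<exists>i\<in>I. w i \<noteq> 0" "\<And>k. k < r \<Longrightarrow> (\<Sum>i\<in>I. w i * A m k $ i) = 0"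
      using underdetermined_system_nontrivial[of I r "\<lambda>k i. A m k $ i"] assms by auto
    define v :: "complex^'n" where "v = (\<chi> i. if i \<in> I then w i else 0)"
    have "v \<noteq> 0" using w(1) by (auto simp: v_def vec_eq_iff)
    moreover have "lin_form (A m k) v = 0" if "k < r" for k
    proof -
      have "lin_form (A m k) v = (\<Sum>i\<in>I. A m k $ i * w i)"
        unfolding lin_form_def v_def by (rule sum.mono_neutral_cong_right) auto
      then show ?thesis using w(2)[OF that] by (simp add: mult.commute)
    qed
    ultimately show ?thesis
      by (intro exI[of _ "(1 / norm v) *\<^sub>R v"])
         (auto simp: v_def lin_form_def scaleR_sum_right[symmetric])
  qed
  then obtain v where v: "\<And>m. norm (v m) = 1" "\<And>m i. i \<notin> I \<Longrightarrow> v m $ i = 0"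
    "\<And>m k. k < r \<Longrightarrow> lin_form (A m k) (v m) = 0" by metis
  have "\<forall>m. v m \<in> sphere 0 1" using v(1) by simp
  then obtain l \<sigma> where \<sigma>: "l \<in> sphere 0 1" "strict_mono (\<sigma> :: nat \<Rightarrow> nat)" "(v \<circ> \<sigma>) \<longlonglongrightarrow> l"
    using compact_sphere[of "0 :: complex^'n" 1]
    unfolding compact_eq_seq_compact_metric seq_compact_def by metis
  have "f (x + c *s l) = f x" for x c
  proof (rule LIMSEQ_unique)
    have sub: "(\<lambda>m. \<Sum>k<r. lin_form (A (\<sigma> m) k) x ^ d) \<longlonglongrightarrow> f x" for x
      using LIMSEQ_subseq_LIMSEQ[OF lim \<sigma>(2)] by (simp add: o_def)
    have cv: "(\<lambda>m. c *s v (\<sigma> m)) \<longlonglongrightarrow> c *s l"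
      using \<sigma>(3) by (intro vec_tendstoI) (auto intro!: tendsto_mult tendsto_vec_nth simp: o_def)
    \<comment> \<open>The direction varies with \<open>m\<close>, which is where convergence at
      moving points enters.\<close>
    show "(\<lambda>m. \<Sum>k<r. lin_form (A (\<sigma> m) k) (x + c *s v (\<sigma> m)) ^ d) \<longlonglongrightarrow> f (x + c *s l)"
      by (rule tendsto_power_sums_moving_point[OF sub tendsto_add[OF tendsto_const cv]])
    show "(\<lambda>m. \<Sum>k<r. lin_form (A (\<sigma> m) k) (x + c *s v (\<sigma> m)) ^ d) \<longlonglongrightarrow> f x"
      using sub[of x] by (simp add: lin_form_add_scale v(3))
  qed
  then have "l \<in> invariant_directions" by (simp add: invariant_directions_def)
  moreover have "l $ i = 0" if "i \<notin> I" for i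
  proof (rule LIMSEQ_unique)
    show "(\<lambda>m. (v \<circ> \<sigma>) m $ i) \<longlonglongrightarrow> l $ i" by (intro tendsto_vec_nth \<sigma>)
    show "(\<lambda>m. (v \<circ> \<sigma>) m $ i) \<longlonglongrightarrow> 0" using v(2)[OF that] by simp
  qed
  moreover have "l \<noteq> 0" using \<sigma>(1) by auto
  ultimately show ?thesis by blast
qed

text \<open>Choose \<open>I\<close> largest such that no nonzero invariant direction is supported on
  it, so that \<open>card I \<le> r\<close>. Maximality makes every axis vector congruent, modulo
  invariant directions, to one supported on \<open>I\<close>; by linearity so is every
  \<open>x\<close>.\<close>

lemma essential_variables:
  obtains N and e \<tau> :: "nat \<Rightarrow> complex^'n"
  where "N \<le> r" "\<And>x. f x = f (\<Sum>l<N. lin_form (\<tau> l) x *s e l)"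
proof -
  let ?K = invariant_directions
  define indep where "indep I \<longleftrightarrow> (\<forall>v\<in>?K. (\<forall>i. i \<notin> I \<longrightarrow> v $ i = 0) \<longrightarrow> v = 0)" for I
  have "indep {}" by (simp add: indep_def vec_eq_iff)
  moreover have "\<forall>J. indep J \<longrightarrow> card J < Suc CARD('n)"
    by (simp add: less_Suc_eq_le card_mono)
  ultimately obtain I where I: "indep I" "\<And>J. indep J \<Longrightarrow> card J \<le> card I"
    using ex_has_greatest_nat[of indep "{}" card "Suc CARD('n)"] by blast
  have cardI: "card I \<le> r"
    using invariant_direction_supported_on[of I] I(1) unfolding indep_def by (meson not_le)
  have "\<exists>t. axis i 1 - t \<in> ?K \<and> (\<forall>j. j \<notin> I \<longrightarrow> t $ j = 0)" for i
  proof (cases "i \<in> I")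
    case True
    then show ?thesis
      using vec.subspace_0[OF subspace_invariant_directions]
      by (intro exI[of _ "axis i 1"]) (auto simp: axis_def)
  next
    case False
    \<comment> \<open>By maximality a nonzero invariant \<open>v\<close> lives on
      \<open>insert i I\<close>; its entry at \<open>i\<close> cannot vanish, so \<open>v\<close>
      eliminates the coordinate \<open>i\<close>.\<close>
    then have "\<not> indep (insert i I)" using I(2)[of "insert i I"] by auto
    then obtain v where v: "v \<in> ?K" "\<And>j. j \<notin> insert i I \<Longrightarrow> v $ j = 0" "v \<noteq> 0"
      unfolding indep_def by blast
    have "v $ i \<noteq> 0"
    proof
      assume "v $ i = 0"
      then have "\<forall>j. j \<notin> I \<longrightarrow> v $ j = 0" by (metis insert_iff v(2))
      then show False using I(1) v(1,3) unfolding indep_def by blast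
    qed
    then show ?thesis
      using vec.subspace_scale[OF subspace_invariant_directions v(1), of "1 / v $ i"] v(2)
      by (intro exI[of _ "axis i 1 - (1 / v $ i) *s v"]) (auto simp: axis_def)
  qed
  then obtain T where T: "\<And>i. axis i 1 - T i \<in> ?K" "\<And>i j. j \<notin> I \<Longrightarrow> T i $ j = 0" by metis
  obtain h where h: "bij_betw h {..<card I} I"
    using ex_bij_betw_nat_finite[of I] by (auto simp: lessThan_atLeast0)
  \<comment> \<open>The entry at \<open>h l\<close> of the reduced vector, as a linear form in
    \<open>x\<close>.\<close>
  define \<tau> :: "nat \<Rightarrow> complex^'n" where "\<tau> l = (\<chi> i. T i $ h l)" for l
  have "f x = f (\<Sum>l<card I. lin_form (\<tau> l) x *s axis (h l) 1)" for x
  proof -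
    define y where "y = (\<Sum>i\<in>UNIV. x $ i *s T i)"
    have "(\<Sum>i\<in>UNIV. x $ i *s (axis i 1 - T i)) \<in> ?K"
      by (intro vec.subspace_sum vec.subspace_scale subspace_invariant_directions T)
    also have "(\<Sum>i\<in>UNIV. x $ i *s (axis i 1 - T i)) = x - y"
      unfolding y_def vec.scale_right_diff_distrib sum_subtractf
      by (simp add: vec_eq_iff axis_def if_distrib[of "\<lambda>x. _ * x"] cong: if_cong)
    finally have "f (y + 1 *s (x - y)) = f y" unfolding invariant_directions_def by blast
    then have "f x = f y" by simp
    also have "y = (\<Sum>j\<in>I. y $ j *s axis j 1)"
      using T(2) by (auto simp: vec_eq_iff y_def axis_def if_distrib[of "\<lambda>x. _ * x"] cong: if_cong)
    also have "\<dots> = (\<Sum>l<card I. y $ h l *s axis (h l) 1)"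
      by (rule sum.reindex_bij_betw[OF h, symmetric])
    also have "(\<lambda>l. y $ h l) = (\<lambda>l. lin_form (\<tau> l) x)"
      by (simp add: fun_eq_iff y_def lin_form_def \<tau>_def mult.commute)
    finally show ?thesis by (simp add: fun_eq_iff)
  qed
  then show ?thesis by (rule that[OF cardI, where \<tau> = \<tau> and e = "\<lambda>l. axis (h l) 1"])
qed

end

section \<open>Debordering\<close>

theorem theorem1:
  fixes f :: "complex^'n::finite \<Rightarrow> complex" and d r :: nat
  assumes "d \<ge> 1"
    and "homog_form d f"
    and "border_waring_rank d f = r"
  shows "waring_rank d f \<le> 4 ^ r * d"
proof -
  \<comment> \<open>Some decomposition must exist before \<open>LeastI\<close> yields one of length
    \<open>r\<close>; the same \<open>v\<close> serves again when \<open>d < r\<close>.\<close>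
  obtain n where "power_sum (range lin_form) d n f"
    using power_sum_of_span[OF subspace_range_lin_form assms(1) homog_form_in_span_powers[OF assms(2)]] ..
  then obtain v where v: "f = (\<lambda>x. \<Sum>k<n. lin_form (v k) x ^ d)"
    unfolding power_sum_range_lin_form_iff waring_decomp_def by blast
  then have "border_waring_decomp d f n"
    unfolding border_waring_decomp_def by (intro exI[of _ "\<lambda>_. v"]) simp
  from LeastI[of "border_waring_decomp d f", OF this] have "border_waring_decomp d f r"
    using assms(3) by (simp add: border_waring_rank_def)
  then obtain A :: "nat \<Rightarrow> nat \<Rightarrow> complex^'n" where
    lim: "\<And>x. (\<lambda>m. \<Sum>k<r. lin_form (A m k) x ^ d) \<longlonglongrightarrow> f x"
    unfolding border_waring_decomp_def by blast
  obtain N and e \<tau> :: "nat \<Rightarrow> complex^'n"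
    where N: "N \<le> r" and f: "\<And>x. f x = f (\<Sum>l<N. lin_form (\<tau> l) x *s e l)"
    by (rule essential_variables[OF lim]) (rule that)
  \<comment> \<open>\<open>g\<close> is \<open>f\<close> on combinations of the vectors
    \<open>e l\<close>, in \<open>N\<close> coordinates; the forms \<open>\<tau> l\<close> lead back
    to \<open>f\<close>.\<close>
  define g where "g w = f (\<Sum>l<N. w l *s e l)" for w
  have lin_e: "lin_form a (\<Sum>l<N. w l *s e l) = lin N (\<lambda>l. lin_form a (e l)) w" for a w
    by (simp add: lin_form_sum_scale lin_def mult.commute)
  have "power_sum (range (lin N)) d (4 ^ r * d) g"
  proof (cases "N = 0")
    case True
    \<comment> \<open>Without variables \<open>g\<close> is the constant \<open>f 0\<close>; this
      case is separate because the limit argument starts from \<open>N \<ge> 1\<close>.\<close>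
    have "f 0 = 0"
      using LIMSEQ_unique[OF lim[of 0]] assms(1) by (simp add: lin_form_def power_0_left)
    then have "g = (\<lambda>x. 0)" using True by (simp add: g_def fun_eq_iff)
    then show ?thesis
      using power_sum_mono[OF power_sum_0 _ subspace_range_lin assms(1)] by simp
  next
    case False
    have "\<exists>s\<le>r. power_sum (range (lin N)) d (2 ^ (N + s) * d) g"
    proof (cases "r \<le> d")
      case True
      have "(\<lambda>m. \<Sum>k<r. lin N w (\<lambda>l. lin_form (A m k) (e l)) ^ d) \<longlonglongrightarrow> g w" for w
        using lim[of "\<Sum>l<N. w l *s e l"] unfolding g_def lin_e by (subst lin_commute)
      then have "power_sum (range (lin N)) d (2 ^ (N + r) * d) g"
        by (rule power_sum_limit_of_powers[rotated 3]) (use False assms(1) True in auto)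
      then show ?thesis by blast
    next
      case r: False
      have "(\<lambda>w. \<Sum>k<n. 1 * lin N (\<lambda>l. lin_form (v k) (e l)) w ^ d) \<in> fun_space.span (monom_funs N d)"
        by (intro span_sum_fun lin_power_in_span_monom_funs)
      then have "g \<in> fun_space.span (monom_funs N d)"
        unfolding g_def[abs_def] v lin_e by simp
      \<comment> \<open>Every monomial of degree \<open>d\<close> appears at \<open>i = d\<close>,
        where the power of the zero form is 1; \<open>s = Suc d\<close> stays at most
        \<open>r\<close> since \<open>d < r\<close>.\<close>
      moreover have "monom_funs N d \<subseteq>
          (\<Union>i\<in>{i. i < Suc d \<and> i \<le> d}. (\<lambda>p x. lin N 0 x ^ (d - i) * p x) ` monom_funs N i)"
      proof
        fix p assume "p \<in> monom_funs N d"
        then show "p \<in> (\<Union>i\<in>{i. i < Suc d \<and> i \<le> d}. (\<lambda>p x. lin N 0 x ^ (d - i) * p x) ` monom_funs N i)"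
          by (intro UN_I[of d] image_eqI[of _ _ p]) auto
      qed
      ultimately have "g \<in> fun_space.span
          (\<Union>i\<in>{i. i < Suc d \<and> i \<le> d}. (\<lambda>p x. lin N 0 x ^ (d - i) * p x) ` monom_funs N i)"
        using fun_space.span_mono by blast
      from power_sum_span_osculating[OF assms(1) this] r show ?thesis
        by (intro exI[of _ "Suc d"]) auto
    qed
    then obtain s where s: "s \<le> r" "power_sum (range (lin N)) d (2 ^ (N + s) * d) g" by blast
    \<comment> \<open>Both \<open>N\<close> and \<open>s\<close> are at most \<open>r\<close>, which
      is where the base 4 comes from.\<close>
    have "(2::nat) ^ (N + s) \<le> 2 ^ (2 * r)" using N s(1) by (intro power_increasing) auto
    then have "2 ^ (N + s) * d \<le> 4 ^ r * d" by (simp add: power_mult)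
    then show ?thesis using power_sum_mono[OF s(2) _ subspace_range_lin assms(1)] by blast
  qed
  then obtain u where u: "\<forall>k<4 ^ r * d. u k \<in> range (lin N)" "g = (\<lambda>w. \<Sum>k<4 ^ r * d. u k w ^ d)"
    unfolding power_sum_def by blast
  have "\<forall>k. \<exists>a. k < 4 ^ r * d \<longrightarrow> u k = lin N a" using u(1) by blast
  then obtain a where a: "\<And>k. k < 4 ^ r * d \<Longrightarrow> u k = lin N (a k)" by metis
  \<comment> \<open>Substituting \<open>\<tau> l\<close> for the variables turns linear forms in
    \<open>N\<close> variables into linear forms in \<open>x\<close>.\<close>
  have "f x = (\<Sum>k<4 ^ r * d. lin_form (\<Sum>l<N. a k l *s \<tau> l) x ^ d)" for x
  proof -
    have "f x = g (\<lambda>l. lin_form (\<tau> l) x)" unfolding g_def by (rule f)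
    also have "\<dots> = (\<Sum>k<4 ^ r * d. lin N (a k) (\<lambda>l. lin_form (\<tau> l) x) ^ d)"
      unfolding u(2) using a by simp
    also have "\<dots> = (\<Sum>k<4 ^ r * d. lin_form (\<Sum>l<N. a k l *s \<tau> l) x ^ d)"
      by (simp add: lin_form_commute[of _ x] lin_form_sum_scale lin_def)
    finally show ?thesis .
  qed
  then have "waring_decomp d f (4 ^ r * d)"
    unfolding waring_decomp_def by (intro exI[of _ "\<lambda>k. \<Sum>l<N. a k l *s \<tau> l"] ext)
  then show ?thesis unfolding waring_rank_def by (rule Least_le)
qed

end
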